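(* Let $X$ be a compact Riemannian manifold of dimension $d$, and let $c>0$ be the constant, depending only on the manifold $X$, such that $$W_1\left(\frac1N\sum_{i=1}^N\delta_{x_i},dx\right)\ge\frac{c}{N^{1/d}}$$ for every $N\ge1$ and every set of points $\{x_1,\dots,x_N\}\subset X$. Then for all sets of points $\{x_1,\dots,x_{N_1}\}\subset X$ and $\{y_1,\dots,y_{N_2}\}\subset X$, $$\mathbf{W}_1^{1,1}\left(\frac{1}{N_1+N_2}\left[\sum_{i=1}^{N_1}\delta_{x_i}-\sum_{j=1}^{N_2}\delta_{y_j}\right],dx\right)\ge\frac{c}{(N_1+N_2)^{1/d}}-\frac{2N_2}{N_1+N_2}.$$
   Context: $\operatorname{dist}$ is the Riemannian distance on $X$ and $dx$ is the Riemannian volume measure normalized so that $dx(X)=1$. $\delta_p$ is the Dirac measure at $p$. $N_1,N_2$ are positive integers. The existence of a constant $c$ as in the claim is a known fact. $\mathcal M(X)$ is the set of positive finite measures on $X$, and $\mathcal M^s(X)$ the set of signed finite measures on $X$. For $\mu\in\mathcal M^s(X)$ with Jordan decomposition $\mu=\mu_+-\mu_-$, the total mass is $|\mu|:=\mu_+(X)+\mu_-(X)$. For $\mu,\nu\in\mathcal M(X)$ with $|\mu|=|\nu|$, $W_1(\mu,\nu)=\min_\pi\int_{X\times X}\operatorname{dist}(x,y)\,d\pi(x,y)$, the minimum being over positive finite measures $\pi$ on $X\times X$ with marginals $\mu$ and $\nu$. For $\mu,\nu\in\mathcal M(X)$ (possibly of different mass), $$W_1^{1,1}(\mu,\nu)=\inf_{\tilde\mu,\tilde\nu\in\mathcal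 M(X),\ |\tilde\mu|=|\tilde\nu|}\ |\mu-\tilde\mu|+|\nu-\tilde\nu|+W_1(\tilde\mu,\tilde\nu).$$ For $\mu,\nu\in\mathcal M^s(X)$, the signed Wasserstein distance is $\mathbf{W}_1^{1,1}(\mu,\nu):=W_1^{1,1}(\mu_++\nu_-,\ \mu_-+\nu_+)$.
   Formalization: As stated the claim fails for large X (circle of length 100, c=25, N1=N2=1). Proved instead: there is c0>0 depending only on X, itself satisfying the W_1 bound, such that the claim holds for every c with the W_1 bound if c≤c0 or if X has diameter at most 2. *)

theory Defs
  imports "HOL-Probability.Probability"
begin

section \<open>Riemannian manifolds\<close>

text \<open>\<open>C\<^sup>k\<close> on an open set, through iterated directional derivatives.\<close>

fun Ck_on :: "nat \<Rightarrow> ('b::euclidean_space) set \<Rightarrow> ('b \<Rightarrow> 'c::real_normed_vector) \<Rightarrow> bool" where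
  "Ck_on 0 S f \<longleftrightarrow> continuous_on S f"
| "Ck_on (Suc k) S f \<longleftrightarrow> (\<forall>x\<in>S. f differentiable (at x)) \<and>
     (\<forall>v. Ck_on k S (\<lambda>x. frechet_derivative f (at x) v))"

definition smooth_on :: "('b::euclidean_space) set \<Rightarrow> ('b \<Rightarrow> 'c::real_normed_vector) \<Rightarrow> bool" where
  "smooth_on S f \<longleftrightarrow> (\<forall>k. Ck_on k S f)"

text \<open>A chart is a pair of its domain and its coordinate map; the values of the coordinate map
  outside the domain are irrelevant.\<close>

type_synonym ('a, 'n) chart = "'a set \<times> ('a \<Rightarrow> real ^ 'n)"

definition is_chart :: "('a::topological_space, 'n::finite) chart \<Rightarrow> bool" where
  "is_chart \<kappa> \<longleftrightarrow> open (fst \<kappa>) \<and> open (snd \<kappa> ` fst \<kappa>) \<and>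
     homeomorphism (fst \<kappa>) (snd \<kappa> ` fst \<kappa>) (snd \<kappa>) (inv_into (fst \<kappa>) (snd \<kappa>))"

definition transition :: "('a, 'n::finite) chart \<Rightarrow> ('a, 'n) chart \<Rightarrow> real ^ 'n \<Rightarrow> real ^ 'n" where
  "transition \<kappa> \<kappa>' = snd \<kappa>' \<circ> inv_into (fst \<kappa>) (snd \<kappa>)"

text \<open>The manifold is the whole type \<open>'a\<close>, its dimension is \<open>CARD('n)\<close>. The atlas need not be maximal.
  The Riemannian metric is given by its local representatives: \<open>g \<kappa> x v w\<close> is the inner product,
  at the point with coordinates \<open>x\<close> in the chart \<open>\<kappa>\<close>, of the tangent vectors with
  components \<open>v\<close> and \<open>w\<close> in that chart. No connectedness is required.\<close>

locale riemannian_manifold =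
  fixes atlas :: "('a::{t2_space, second_countable_topology}, 'n::finite) chart set"
    and g :: "('a, 'n) chart \<Rightarrow> real ^ 'n \<Rightarrow> real ^ 'n \<Rightarrow> real ^ 'n \<Rightarrow> real"
  assumes charts: "\<And>\<kappa>. \<kappa> \<in> atlas \<Longrightarrow> is_chart \<kappa>"
    and cover: "(\<Union>\<kappa>\<in>atlas. fst \<kappa>) = UNIV"
    and smooth_transition: "\<And>\<kappa> \<kappa>'. \<kappa> \<in> atlas \<Longrightarrow> \<kappa>' \<in> atlas \<Longrightarrow>
          smooth_on (snd \<kappa> ` (fst \<kappa> \<inter> fst \<kappa>')) (transition \<kappa> \<kappa>')"
    and metric_bilinear: "\<And>\<kappa> x. \<kappa> \<in> atlas \<Longrightarrow> x \<in> snd \<kappa> ` fst \<kappa> \<Longrightarrow> bilinear (g \<kappa> x)"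
    and metric_sym: "\<And>\<kappa> x v w. \<kappa> \<in> atlas \<Longrightarrow> x \<in> snd \<kappa> ` fst \<kappa> \<Longrightarrow> g \<kappa> x v w = g \<kappa> x w v"
    and metric_pos: "\<And>\<kappa> x v. \<kappa> \<in> atlas \<Longrightarrow> x \<in> snd \<kappa> ` fst \<kappa> \<Longrightarrow> v \<noteq> 0 \<Longrightarrow> g \<kappa> x v v > 0"
    and metric_smooth: "\<And>\<kappa> v w. \<kappa> \<in> atlas \<Longrightarrow> smooth_on (snd \<kappa> ` fst \<kappa>) (\<lambda>x. g \<kappa> x v w)"
    and metric_compat: "\<And>\<kappa> \<kappa>' x v w. \<kappa> \<in> atlas \<Longrightarrow> \<kappa>' \<in> atlas \<Longrightarrow>
          x \<in> snd \<kappa> ` (fst \<kappa> \<inter> fst \<kappa>') \<Longrightarrow>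
          g \<kappa> x v w = g \<kappa>' (transition \<kappa> \<kappa>' x)
             (frechet_derivative (transition \<kappa> \<kappa>') (at x) v)
             (frechet_derivative (transition \<kappa> \<kappa>') (at x) w)"

text \<open>Piecewise \<open>C\<^sup>1\<close> curves on \<open>[0,1]\<close>. One-sided limits of the derivative at the finitely many break
  points are not required; this does not affect the infimum of the lengths.\<close>

definition piecewise_C1_curve ::
    "('a::topological_space, 'n::finite) chart set \<Rightarrow> (real \<Rightarrow> 'a) \<Rightarrow> bool" where
  "piecewise_C1_curve atlas \<gamma> \<longleftrightarrow> continuous_on {0..1} \<gamma> \<and>
     (\<exists>S. finite S \<and> (\<forall>\<kappa>\<in>atlas.
        (snd \<kappa> \<circ> \<gamma>) C1_differentiable_on {t \<in> {0<..<1} - S. \<gamma> t \<in> fst \<kappa>}))"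

text \<open>The Riemannian norm of the velocity does not depend on the chart, by the compatibility
  condition on the metric.\<close>

definition speed :: "('a, 'n::finite) chart set \<Rightarrow>
    (('a, 'n) chart \<Rightarrow> real ^ 'n \<Rightarrow> real ^ 'n \<Rightarrow> real ^ 'n \<Rightarrow> real) \<Rightarrow> (real \<Rightarrow> 'a) \<Rightarrow> real \<Rightarrow> real" where
  "speed atlas g \<gamma> t =
     (let \<kappa> = (SOME \<kappa>. \<kappa> \<in> atlas \<and> \<gamma> t \<in> fst \<kappa>);
          v = vector_derivative (snd \<kappa> \<circ> \<gamma>) (at t)
      in sqrt (g \<kappa> (snd \<kappa> (\<gamma> t)) v v))"

definition curve_length :: "('a, 'n::finite) chart set \<Rightarrow>
    (('a, 'n) chart \<Rightarrow> real ^ 'n \<Rightarrow> real ^ 'n \<Rightarrow> real ^ 'n \<Rightarrow> real) \<Rightarrow> (real \<Rightarrow> 'a) \<Rightarrow> ennreal" where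
  "curve_length atlas g \<gamma> = (\<integral>\<^sup>+t\<in>{0..1}. ennreal (speed atlas g \<gamma> t) \<partial>lborel)"

text \<open>Points in different connected components have distance \<open>\<infinity>\<close>.\<close>

definition riemannian_dist :: "('a::topological_space, 'n::finite) chart set \<Rightarrow>
    (('a, 'n) chart \<Rightarrow> real ^ 'n \<Rightarrow> real ^ 'n \<Rightarrow> real ^ 'n \<Rightarrow> real) \<Rightarrow> 'a \<Rightarrow> 'a \<Rightarrow> ennreal" where
  "riemannian_dist atlas g p q =
     (INF \<gamma>\<in>{\<gamma>. piecewise_C1_curve atlas \<gamma> \<and> \<gamma> 0 = p \<and> \<gamma> 1 = q}. curve_length atlas g \<gamma>)"

text \<open>The Riemannian volume measure is the unique Borel measure with density \<open>sqrt (det (g\<^sub>i\<^sub>j))\<close> with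
  respect to Lebesgue measure in every chart.\<close>

definition riemannian_volume :: "('a::topological_space, 'n::finite) chart set \<Rightarrow>
    (('a, 'n) chart \<Rightarrow> real ^ 'n \<Rightarrow> real ^ 'n \<Rightarrow> real ^ 'n \<Rightarrow> real) \<Rightarrow> 'a measure \<Rightarrow> bool" where
  "riemannian_volume atlas g vol \<longleftrightarrow> sets vol = sets borel \<and>
     (\<forall>\<kappa>\<in>atlas. \<forall>A\<in>sets borel. A \<subseteq> fst \<kappa> \<longrightarrow>
        emeasure vol A =
          (\<integral>\<^sup>+x\<in>snd \<kappa> ` A. ennreal (sqrt (det (\<chi> i j. g \<kappa> x (axis i 1) (axis j 1)))) \<partial>lborel))"

definition normalized :: "'a measure \<Rightarrow> 'a measure" where
  "normalized M = scale_measure (1 / emeasure M (space M)) M"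

section \<open>Finite measures and signed measures\<close>

definition finite_borel_measures :: "'a::topological_space measure set" where
  "finite_borel_measures = {M. sets M = sets borel \<and> finite_measure M}"

definition add_measure :: "'a::topological_space measure \<Rightarrow> 'a measure \<Rightarrow> 'a measure" where
  "add_measure M N = measure_of UNIV (sets borel) (\<lambda>A. emeasure M A + emeasure N A)"

definition empirical :: "nat \<Rightarrow> (nat \<Rightarrow> 'a::topological_space) \<Rightarrow> 'a measure" where
  "empirical N x = measure_of UNIV (sets borel)
     (\<lambda>A. ennreal (1 / real N) * (\<Sum>i<N. emeasure (return borel (x i)) A))"

text \<open>A signed finite measure is represented by its values on the Borel sets. A positive finite
  measure \<open>M\<close>, viewed as a signed one, is \<open>measure M\<close>.\<close>

definition jordan_decomposition ::
    "('a::topological_space set \<Rightarrow> real) \<Rightarrow> 'a measure \<Rightarrow> 'a measure \<Rightarrow> bool" where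
  "jordan_decomposition s P N \<longleftrightarrow>
     P \<in> finite_borel_measures \<and> N \<in> finite_borel_measures \<and>
     (\<forall>A\<in>sets borel. s A = measure P A - measure N A) \<and>
     (\<exists>H\<in>sets borel. measure P (- H) = 0 \<and> measure N H = 0)"

definition jordan_pos :: "('a::topological_space set \<Rightarrow> real) \<Rightarrow> 'a measure" where
  "jordan_pos s = (THE P. \<exists>N. jordan_decomposition s P N)"

definition jordan_neg :: "('a::topological_space set \<Rightarrow> real) \<Rightarrow> 'a measure" where
  "jordan_neg s = (THE N. \<exists>P. jordan_decomposition s P N)"

definition total_mass :: "('a::topological_space set \<Rightarrow> real) \<Rightarrow> ennreal" where
  "total_mass s = emeasure (jordan_pos s) UNIV + emeasure (jordan_neg s) UNIV"

section \<open>Wasserstein distances for a distance function \<open>D\<close>\<close>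

definition couplings :: "'a::topological_space measure \<Rightarrow> 'a measure \<Rightarrow> ('a \<times> 'a) measure set" where
  "couplings M N = {\<pi>. sets \<pi> = sets (borel \<Otimes>\<^sub>M borel) \<and> finite_measure \<pi> \<and>
     distr \<pi> borel fst = M \<and> distr \<pi> borel snd = N}"

definition W1 :: "('a::topological_space \<Rightarrow> 'a \<Rightarrow> ennreal) \<Rightarrow> 'a measure \<Rightarrow> 'a measure \<Rightarrow> ennreal" where
  "W1 D M N = (INF \<pi>\<in>couplings M N. \<integral>\<^sup>+z. D (fst z) (snd z) \<partial>\<pi>)"

definition W11 :: "('a::topological_space \<Rightarrow> 'a \<Rightarrow> ennreal) \<Rightarrow> 'a measure \<Rightarrow> 'a measure \<Rightarrow> ennreal" where
  "W11 D M N =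
     (INF (M', N')\<in>{(M', N'). M' \<in> finite_borel_measures \<and> N' \<in> finite_borel_measures \<and>
                             emeasure M' UNIV = emeasure N' UNIV}.
        total_mass (\<lambda>A. measure M A - measure M' A) +
        total_mass (\<lambda>A. measure N A - measure N' A) + W1 D M' N')"

definition signed_W11 :: "('a::topological_space \<Rightarrow> 'a \<Rightarrow> ennreal) \<Rightarrow>
    ('a set \<Rightarrow> real) \<Rightarrow> ('a set \<Rightarrow> real) \<Rightarrow> ennreal" where
  "signed_W11 D s t =
     W11 D (add_measure (jordan_pos s) (jordan_neg t)) (add_measure (jordan_neg s) (jordan_pos t))"

definition signed_empirical ::
    "nat \<Rightarrow> nat \<Rightarrow> (nat \<Rightarrow> 'a::topological_space) \<Rightarrow> (nat \<Rightarrow> 'a) \<Rightarrow> 'a set \<Rightarrow> real" where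
  "signed_empirical N1 N2 x y A = 1 / real (N1 + N2) *
     ((\<Sum>i<N1. measure (return borel (x i)) A) - (\<Sum>j<N2. measure (return borel (y j)) A))"

text \<open>The property of the constant \<open>c\<close> in dimension \<open>d\<close>. The points \<open>x 0, \<dots>, x (N - 1)\<close> may coincide.\<close>

definition empirical_W1_bound ::
    "('a::topological_space \<Rightarrow> 'a \<Rightarrow> ennreal) \<Rightarrow> 'a measure \<Rightarrow> nat \<Rightarrow> real \<Rightarrow> bool" where
  "empirical_W1_bound D dx d c \<longleftrightarrow>
     (\<forall>N\<ge>1. \<forall>x. ereal (c / real N powr (1 / real d)) \<le> enn2ereal (W1 D (empirical N x) dx))"

end

theory Submission
  imports Defs
begin

text \<open>
  With \<open>\<mu> = 1/N \<Sum>\<delta>\<^sub>x\<close>, \<open>\<nu> = 1/N \<Sum>\<delta>\<^sub>y\<close>, \<open>N = N1 + N2\<close>, the probability measure \<open>\<mu> + \<nu>\<close> is the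
  empirical measure of all \<open>N\<close> points. Moving the mass of \<open>\<nu>\<close> from one side to the other changes
  \<open>W11\<close> by at most \<open>2|\<nu>| = 2 N2 / N\<close>, so it suffices that \<open>W11 (\<mu> + \<nu>) dx \<ge> c / N powr (1/d)\<close>.

  Removing one unit of mass on both sides costs 2. If the diameter is at most 2, transporting that
  unit is no more expensive, hence \<open>W1 \<le> W11\<close> between probability measures: a coupling of modified
  marginals is cut down by Radon-Nikodym densities to a coupling of submeasures of the original
  marginals and completed by a product measure.

  Without a bound on the diameter, the constant \<open>c0\<close> is chosen so that the estimate holds for \<open>W11\<close>
  itself: in a chart the distance dominates a multiple of the Euclidean one, so balls of radius \<open>r\<close>
  have volume \<open>O(r^d)\<close>, and for \<open>r\<close> a small multiple of \<open>1 / N powr (1/d)\<close> half of the volume is at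
  distance at least \<open>r\<close> from all \<open>N\<close> points; this half is either transported or removed.
\<close>

section \<open>Finite measures and total mass\<close>

lemma finite_borel_measuresD:
  assumes "M \<in> finite_borel_measures"
  shows "sets M = sets borel" "space M = UNIV" "finite_measure M"
  using assms sets_eq_imp_space_eq[of M borel] by (auto simp: finite_borel_measures_def)

lemma measure_add_Compl:
  assumes "M \<in> finite_borel_measures" "A \<in> sets borel"
  shows "measure M A + measure M (- A) = measure M UNIV"
  using finite_borel_measuresD[OF assms(1)] assms(2)
  by (subst finite_measure.finite_measure_Union[symmetric]) auto

lemma finite_borel_measures_eqI:
  assumes "M \<in> finite_borel_measures" "N \<in> finite_borel_measures"
    and "\<And>A. A \<in> sets borel \<Longrightarrow> measure M A = measure N A"
  shows "M = N"
  using assms finite_borel_measuresD[OF assms(1)] finite_borel_measuresD[OF assms(2)]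
  by (intro measure_eqI) (auto simp: finite_measure.emeasure_eq_measure)

section \<open>Sums of Borel measures\<close>

lemma sets_add_measure [simp]: "sets (add_measure M N) = sets borel"
  unfolding add_measure_def using sets.sets_measure_of_eq[of borel] by simp

lemma space_add_measure [simp]: "space (add_measure M N) = UNIV"
  unfolding add_measure_def by (simp add: space_measure_of_conv)

lemma emeasure_add_measure:
  assumes "sets M = sets borel" "sets N = sets borel"
  shows "emeasure (add_measure M N) A = emeasure M A + emeasure N A"
proof (cases "A \<in> sets borel")
  case True
  show ?thesis
    unfolding add_measure_def
  proof (rule emeasure_measure_of_sigma)
    show "sigma_algebra UNIV (sets borel)"
      using sets.sigma_algebra_axioms[of borel] by simp
    show "countably_additive (sets borel) (\<lambda>A. emeasure M A + emeasure N A)"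
      using assms
      by (intro countably_additiveI) (simp add: suminf_add[symmetric] suminf_emeasure image_subset_iff)
  qed (use True in \<open>auto simp: positive_def\<close>)
next
  case False
  then show ?thesis
    using assms by (simp add: emeasure_notin_sets)
qed

lemma add_measure_finite [simp]:
  assumes "M \<in> finite_borel_measures" "N \<in> finite_borel_measures"
  shows "add_measure M N \<in> finite_borel_measures"
    and "measure (add_measure M N) A = measure M A + measure N A"
proof -
  note M = finite_borel_measuresD[OF assms(1)] and N = finite_borel_measuresD[OF assms(2)]
  have eq: "emeasure (add_measure M N) A = ennreal (measure M A + measure N A)" for A
    using M N by (simp add: emeasure_add_measure finite_measure.emeasure_eq_measure)
  show "add_measure M N \<in> finite_borel_measures"
    by (simp add: finite_borel_measures_def finite_measureI eq)
  show "measure (add_measure M N) A = measure M A + measure N A"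
    by (simp add: measure_def[of "add_measure M N"] eq del: ennreal_plus)
qed

text \<open>On its own Hahn set \<open>H\<close> the first decomposition has no negative part, so
  \<open>P1 A\<close> equals \<open>s (A \<inter> H)\<close>, which is at most
  \<open>P2 (A \<inter> H)\<close> and hence at most \<open>P2 A\<close>. Exchanging the roles gives
  equality. This gives the definite descriptions \<open>jordan_pos\<close> and
  \<open>jordan_neg\<close> their meaning.\<close>

lemma jordan_decomposition_unique:
  assumes PN: "jordan_decomposition s P N" and PN': "jordan_decomposition s P' N'"
  shows "P = P' \<and> N = N'"
proof -
  have le: "measure P1 A \<le> measure P2 A"
    if "jordan_decomposition s P1 N1" "jordan_decomposition s P2 N2" "A \<in> sets borel"
    for P1 N1 P2 N2 and A :: "'a set"
  proof -
    from that(1) obtain H where H: "H \<in> sets borel" "measure P1 (- H) = 0" "measure N1 H = 0"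
      and P1: "P1 \<in> finite_borel_measures" and N1: "N1 \<in> finite_borel_measures"
      by (auto simp: jordan_decomposition_def)
    from that(2) have P2: "P2 \<in> finite_borel_measures" by (simp add: jordan_decomposition_def)
    note d = finite_borel_measuresD[OF P1] finite_borel_measuresD[OF N1] finite_borel_measuresD[OF P2]
    note fm = finite_measure.finite_measure_mono
    have "measure P1 A = measure P1 (A \<inter> H) + measure P1 (A - H)"
      using d that H by (subst finite_measure.finite_measure_Union[symmetric]) (auto simp: Int_Diff_Un)
    moreover have "measure P1 (A - H) \<le> measure P1 (- H)"
      using d H that by (intro fm) auto
    moreover have "measure N1 (A \<inter> H) \<le> measure N1 H"
      using d H that by (intro fm) auto
    moreover have "measure P1 (A \<inter> H) - measure N1 (A \<inter> H) = s (A \<inter> H)"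
      "s (A \<inter> H) = measure P2 (A \<inter> H) - measure N2 (A \<inter> H)"
      using that H by (auto simp: jordan_decomposition_def)
    moreover have "measure P2 (A \<inter> H) \<le> measure P2 A"
      using d H that by (intro fm) auto
    ultimately show ?thesis using H by (smt (verit) measure_nonneg)
  qed
  have P: "measure P A = measure P' A" if "A \<in> sets borel" for A
    using le[OF PN PN' that] le[OF PN' PN that] by simp
  have N: "measure N A = measure N' A" if "A \<in> sets borel" for A
    using P[OF that] PN PN' that unfolding jordan_decomposition_def by (metis diff_left_imp_eq)
  show ?thesis
    using PN PN' P N by (auto simp: jordan_decomposition_def intro!: finite_borel_measures_eqI)
qed

lemma jordan_eq:
  assumes "jordan_decomposition s P N"
  shows "jordan_pos s = P" "jordan_neg s = N"
  unfolding jordan_pos_def jordan_neg_def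
  by (rule the_equality; use assms jordan_decomposition_unique[OF assms] in blast)+

lemma jordan_decomposition_measure:
  assumes "M \<in> finite_borel_measures"
  shows "jordan_decomposition (measure M) M (null_measure borel)"
proof -
  have "null_measure borel \<in> finite_borel_measures"
    by (auto simp: finite_borel_measures_def intro!: finite_measureI)
  moreover have "UNIV \<in> sets borel \<and> measure M (- UNIV) = 0 \<and> measure (null_measure borel) UNIV = 0"
    by (simp add: measure_def)
  ultimately show ?thesis
    using assms unfolding jordan_decomposition_def
    by (intro conjI ballI bexI[of _ UNIV]) (auto simp: measure_def[of "null_measure _"])
qed

text \<open>\<open>P'\<close> is \<open>P - N\<close> restricted to a Hahn set \<open>H\<close>, and
  \<open>N'\<close> is \<open>N - P\<close> restricted to its complement. The bound of
  \<open>P'\<close> by \<open>P\<close> records that the mass common to \<open>P\<close> and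
  \<open>N\<close> cancels; the later mass estimates rely on it.\<close>

lemma ex_jordan_decomposition:
  fixes P N :: "'a::topological_space measure"
  assumes P: "P \<in> finite_borel_measures" and N: "N \<in> finite_borel_measures"
  obtains P' N' H where "jordan_decomposition (\<lambda>A. measure P A - measure N A) P' N'"
    and "H \<in> sets borel" and "measure P' (- H) = 0" and "measure N' H = 0"
    and "\<And>A. A \<in> sets borel \<Longrightarrow> measure P' A \<le> measure P A"
proof -
  note dP = finite_borel_measuresD[OF P] and dN = finite_borel_measuresD[OF N]
  note fin = dP(3) dN(3)
  note [simp] = dP(1) dN(1) dP(2) dN(2)
  note em = finite_measure.emeasure_eq_measure[OF fin(1)] finite_measure.emeasure_eq_measure[OF fin(2)]
  obtain H where H: "H \<in> sets P"
    "\<And>X. X \<in> sets P \<Longrightarrow> X \<subseteq> H \<Longrightarrow> emeasure N X \<le> emeasure P X"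
    "\<And>X. X \<in> sets P \<Longrightarrow> X \<inter> H = {} \<Longrightarrow> emeasure P X \<le> emeasure N X"
    using finite_unsigned_Hahn_decomposition[OF fin] by auto
  have Hb: "H \<in> sets borel" using H(1) by simp
  have hP: "measure N (A \<inter> H) \<le> measure P (A \<inter> H)" and hN: "measure P (A - H) \<le> measure N (A - H)"
    if "A \<in> sets borel" for A
    using H(2)[of "A \<inter> H"] H(3)[of "A - H"] that Hb by (auto simp: em)
  \<comment> \<open>Restriction to \<open>K\<close> is written as a density so that the measure
    still lives on all Borel sets of the whole type, as \<open>finite_borel_measures\<close>
    requires.\<close>
  let ?R = "\<lambda>M K. density M (indicator K)"
  have R: "emeasure (?R M K) A = ennreal (measure M (A \<inter> K))" "finite_measure (?R M K)"
    if "M \<in> finite_borel_measures" "K \<in> sets borel" "A \<in> sets borel" for M K and A :: "'a set"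
  proof -
    note d = finite_borel_measuresD[OF that(1)]
    have *: "emeasure (?R M K) B = ennreal (measure M (B \<inter> K))" if "B \<in> sets borel" for B
      using that \<open>K \<in> sets borel\<close> d
      by (simp add: emeasure_density finite_measure.emeasure_eq_measure[symmetric]
          nn_integral_indicator indicator_inter_arith[symmetric] Int_commute)
    show "emeasure (?R M K) A = ennreal (measure M (A \<inter> K))" using * that by simp
    show "finite_measure (?R M K)" using *[of UNIV] d by (intro finite_measureI) simp
  qed
  define P' where "P' = diff_measure (?R P H) (?R N H)"
  define N' where "N' = diff_measure (?R N (- H)) (?R P (- H))"
  have [simp]: "sets P' = sets borel" "sets N' = sets borel" "space P' = UNIV" "space N' = UNIV"
    by (simp_all add: P'_def N'_def)
  have eP: "emeasure P' A = ennreal (measure P (A \<inter> H) - measure N (A \<inter> H))" if "A \<in> sets borel" for A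
    unfolding P'_def using that Hb R[OF P Hb] R[OF N Hb] hP
    by (subst emeasure_diff_measure) (auto simp: ennreal_minus ennreal_leI)
  have Hc: "- H \<in> sets borel" using Hb by auto
  have eN: "emeasure N' A = ennreal (measure N (A - H) - measure P (A - H))" if "A \<in> sets borel" for A
    unfolding N'_def using that Hc R[OF P Hc] R[OF N Hc] hN
    by (subst emeasure_diff_measure) (auto simp: ennreal_minus ennreal_leI Diff_eq[symmetric])
  have mP: "measure P' A = measure P (A \<inter> H) - measure N (A \<inter> H)" if "A \<in> sets borel" for A
    using eP[OF that] hP[OF that] by (simp add: measure_def)
  have mN: "measure N' A = measure N (A - H) - measure P (A - H)" if "A \<in> sets borel" for A
    using eN[OF that] hN[OF that] by (simp add: measure_def)
  have fP': "P' \<in> finite_borel_measures" and fN': "N' \<in> finite_borel_measures"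
    using eP[of UNIV] eN[of UNIV] by (auto simp: finite_borel_measures_def intro!: finite_measureI)
  have split: "measure M A = measure M (A \<inter> H) + measure M (A - H)"
    if "M \<in> finite_borel_measures" "A \<in> sets borel" for M A
    using finite_borel_measuresD[OF that(1)] that Hb
    by (subst finite_measure.finite_measure_Union[symmetric]) (auto simp: Int_Diff_Un)
  have z: "measure P' (- H) = 0" "measure N' H = 0"
    using mP[of "- H"] mN[of H] Hb Hc by simp_all
  have jd: "jordan_decomposition (\<lambda>A. measure P A - measure N A) P' N'"
    unfolding jordan_decomposition_def
  proof (intro conjI ballI)
    show "measure P A - measure N A = measure P' A - measure N' A" if "A \<in> sets borel" for A
      using split[OF P that] split[OF N that] mP[OF that] mN[OF that] by linarith
  qed (use fP' fN' z Hb in auto)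
  have "measure P' A \<le> measure P A" if "A \<in> sets borel" for A
    using mP[OF that] split[OF P that] by (smt (verit) measure_nonneg)
  then show ?thesis using that[OF jd Hb z] by blast
qed

text \<open>With \<open>s = P - N\<close>, the total variation is the maximum of
  \<open>s B - s (- B)\<close> over Borel sets \<open>B\<close>, and a Hahn set attains it. The real
  number \<open>t\<close> also shows that the value is finite.\<close>

lemma total_mass_attained:
  assumes P: "P \<in> finite_borel_measures" and N: "N \<in> finite_borel_measures"
  obtains H t where "H \<in> sets borel"
    "total_mass (\<lambda>A. measure P A - measure N A) = ennreal t"
    "t = (measure P H - measure N H) - (measure P (- H) - measure N (- H))" "t \<ge> 0"
proof -
  obtain P' N' H where j: "jordan_decomposition (\<lambda>A. measure P A - measure N A) P' N'"
    and H: "H \<in> sets borel" "measure P' (- H) = 0" "measure N' H = 0"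
    using ex_jordan_decomposition[OF P N] by metis
  from j have fP: "P' \<in> finite_borel_measures" and fN: "N' \<in> finite_borel_measures"
    and eq: "\<And>A. A \<in> sets borel \<Longrightarrow> measure P A - measure N A = measure P' A - measure N' A"
    by (auto simp: jordan_decomposition_def)
  have "measure M UNIV = measure M H + measure M (- H)" if "M \<in> finite_borel_measures" for M
    using finite_borel_measuresD[OF that] H
    by (subst finite_measure.finite_measure_Union[symmetric]) auto
  from this[OF fP] this[OF fN]
  have m: "measure P' UNIV = measure P' H" "measure N' UNIV = measure N' (- H)"
    using H by auto
  have "total_mass (\<lambda>A. measure P A - measure N A) = ennreal (measure P' UNIV + measure N' UNIV)"
    unfolding total_mass_def jordan_eq[OF j]
    using finite_borel_measuresD[OF fP] finite_borel_measuresD[OF fN]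
    by (simp add: finite_measure.emeasure_eq_measure)
  then show ?thesis
    using that[of H "measure P' UNIV + measure N' UNIV"] H m eq[of H] eq[of "- H"] by auto
qed

text \<open>The other half of the variational formula: \<open>s B\<close> is at most
  \<open>P' B\<close> and \<open>- s (- B)\<close> is at most \<open>N' (- B)\<close>, for the
  Jordan parts \<open>P'\<close> and \<open>N'\<close> of \<open>s = P - N\<close>. Removed mass is
  bounded below by a good choice of \<open>B\<close>.\<close>

lemma total_mass_ge:
  assumes P: "P \<in> finite_borel_measures" and N: "N \<in> finite_borel_measures" and B: "B \<in> sets borel"
  shows "ennreal ((measure P B - measure N B) - (measure P (- B) - measure N (- B)))
    \<le> total_mass (\<lambda>A. measure P A - measure N A)"
proof -
  obtain P' N' H where j: "jordan_decomposition (\<lambda>A. measure P A - measure N A) P' N'"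
    using ex_jordan_decomposition[OF P N] by metis
  from j have fP: "P' \<in> finite_borel_measures" and fN: "N' \<in> finite_borel_measures"
    and eq: "\<And>A. A \<in> sets borel \<Longrightarrow> measure P A - measure N A = measure P' A - measure N' A"
    by (auto simp: jordan_decomposition_def)
  have "measure M B \<le> measure M UNIV" "measure M (- B) \<le> measure M UNIV"
    "measure M UNIV = measure M B + measure M (- B)" if "M \<in> finite_borel_measures" for M
    subgoal using finite_borel_measuresD[OF that] by (intro finite_measure.finite_measure_mono) auto
    subgoal using finite_borel_measuresD[OF that] by (intro finite_measure.finite_measure_mono) auto
    subgoal using finite_borel_measuresD[OF that] B
      by (subst finite_measure.finite_measure_Union[symmetric]) auto
    done
  from this[OF fP] this[OF fN] eq[OF B] eq[of "- B"] B
  have "(measure P B - measure N B) - (measure P (- B) - measure N (- B))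
      \<le> measure P' UNIV + measure N' UNIV"
    using measure_nonneg[of N' B] measure_nonneg[of P' "- B"]
    by auto
  moreover have "total_mass (\<lambda>A. measure P A - measure N A) = ennreal (measure P' UNIV + measure N' UNIV)"
    unfolding total_mass_def jordan_eq[OF j]
    using finite_borel_measuresD[OF fP] finite_borel_measuresD[OF fN]
    by (simp add: finite_measure.emeasure_eq_measure)
  ultimately show ?thesis by (simp add: ennreal_leI del: ennreal_plus)
qed

text \<open>A triangle inequality for total variation, read off at a Hahn set \<open>H\<close> of
  \<open>P - N\<close>, where replacing \<open>P\<close> by \<open>Q\<close> changes the value by at
  most \<open>k H + k (- H)\<close>. Taking a set function \<open>k\<close> instead of a measure
  admits differences such as \<open>2 * measure \<nu> A - measure N A\<close>.\<close>

lemma total_mass_le_add: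
  assumes P: "P \<in> finite_borel_measures" and Q: "Q \<in> finite_borel_measures"
    and N: "N \<in> finite_borel_measures"
    and "\<And>A. A \<in> sets borel \<Longrightarrow> \<bar>measure P A - measure Q A\<bar> \<le> k A"
    and "\<And>A. A \<in> sets borel \<Longrightarrow> k A + k (- A) = K"
  shows "total_mass (\<lambda>A. measure P A - measure N A)
    \<le> total_mass (\<lambda>A. measure Q A - measure N A) + ennreal K"
proof -
  obtain H t where H: "H \<in> sets borel" and
    t: "total_mass (\<lambda>A. measure P A - measure N A) = ennreal t"
    "t = (measure P H - measure N H) - (measure P (- H) - measure N (- H))"
    by (rule total_mass_attained[OF P N])
  define u where "u = (measure Q H - measure N H) - (measure Q (- H) - measure N (- H))"
  have K: "t \<le> u + K" "0 \<le> K"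
    using assms(4)[of H] assms(4)[of "- H"] assms(5)[of H] H unfolding t(2) u_def by auto
  have "ennreal t \<le> ennreal u + ennreal K"
  \<comment> \<open>\<open>H\<close> is chosen for \<open>P\<close> and not for \<open>Q\<close>, so
    \<open>u\<close> can be negative; \<open>ennreal\<close> then sends it to 0, and
    \<open>t \<le> K\<close> suffices.\<close>
  proof (cases "u \<ge> 0")
    case True then show ?thesis using K by (simp add: ennreal_plus[symmetric] ennreal_leI del: ennreal_plus)
  next
    case False
    then have "ennreal t \<le> ennreal K" using K by (intro ennreal_leI) auto
    then show ?thesis by (metis add.commute add_increasing2 zero_le)
  qed
  then show ?thesis
    unfolding t(1) using total_mass_ge[OF Q N H] unfolding u_def
    by (meson add_right_mono order_trans)
qed

lemma total_mass_zero:
  "total_mass (\<lambda>A. 0 :: real) = 0"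
  by (rule total_mass_attained[of "null_measure borel" "null_measure borel"])
    (auto simp: finite_borel_measures_def finite_measureI)

text \<open>Reduces a lower bound to one competitor and one coupling. \<open>W1\<close> is an
  infimum inside a sum, so the total masses are subtracted first, which their finiteness
  allows.\<close>

lemma W11_greatest:
  assumes E: "E \<in> finite_borel_measures" and F: "F \<in> finite_borel_measures"
    and le: "\<And>M N \<pi>. \<lbrakk>M \<in> finite_borel_measures; N \<in> finite_borel_measures;
      emeasure M UNIV = emeasure N UNIV; \<pi> \<in> couplings M N\<rbrakk> \<Longrightarrow>
      b \<le> total_mass (\<lambda>A. measure E A - measure M A) +
        total_mass (\<lambda>A. measure F A - measure N A) + (\<integral>\<^sup>+z. D (fst z) (snd z) \<partial>\<pi>)"
  shows "b \<le> W11 D E F"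
  unfolding W11_def
proof (rule INF_greatest, clarify)
  fix M N :: "'a measure"
  assume M: "M \<in> finite_borel_measures" and N: "N \<in> finite_borel_measures"
    and eq: "emeasure M UNIV = emeasure N UNIV"
  define T where "T = total_mass (\<lambda>A. measure E A - measure M A) +
        total_mass (\<lambda>A. measure F A - measure N A)"
  have fin: "total_mass (\<lambda>A. measure P A - measure Q A) \<noteq> top"
    if "P \<in> finite_borel_measures" "Q \<in> finite_borel_measures" for P Q :: "'a measure"
    using total_mass_attained[OF that] by (metis ennreal_neq_top)
  have T: "T \<noteq> top" unfolding T_def using fin[OF E M] fin[OF F N] by simp
  have "b - T \<le> W1 D M N"
    unfolding W1_def
    by (rule INF_greatest) (use le[OF M N eq] T in \<open>auto simp: ennreal_minus_le_iff T_def\<close>)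
  then show "b \<le> T + W1 D M N"
    using T by (simp add: ennreal_minus_le_iff)
qed

lemma W11_le_W1:
  assumes "M \<in> finite_borel_measures" "N \<in> finite_borel_measures" "emeasure M UNIV = emeasure N UNIV"
  shows "W11 D M N \<le> W1 D M N"
  unfolding W11_def by (rule INF_lower2[of "(M, N)"]) (use assms in \<open>auto simp: total_mass_zero\<close>)

section \<open>Empirical measures\<close>

lemma measure_return_UNIV [simp]: "measure (return borel p) UNIV = 1"
  using prob_space.prob_space[OF prob_space_return[of p borel]] by simp

lemma
  fixes x :: "nat \<Rightarrow> 'a::topological_space"
  assumes "N > 0"
  shows empirical_finite: "empirical N x \<in> finite_borel_measures"
    and measure_empirical: "\<And>A. measure (empirical N x) A = 1 / real N * (\<Sum>i<N. measure (return borel (x i)) A)"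
    and empirical_UNIV: "measure (empirical N x) UNIV = 1"
proof -
  have sets [simp]: "sets (empirical N x) = sets borel"
    unfolding empirical_def using sets.sets_measure_of_eq[of borel] by simp
  have sp [simp]: "space (empirical N x) = UNIV"
    unfolding empirical_def by (simp add: space_measure_of_conv)
  have em: "emeasure (empirical N x) A = ennreal (1 / real N) * (\<Sum>i<N. emeasure (return borel (x i)) A)"
    if "A \<in> sets borel" for A
    unfolding empirical_def
  proof (rule emeasure_measure_of_sigma)
    show "sigma_algebra UNIV (sets (borel :: 'a measure))"
      using sets.sigma_algebra_axioms[of "borel :: 'a measure"] by simp
    show "countably_additive (sets borel)
        (\<lambda>A. ennreal (1 / real N) * (\<Sum>i<N. emeasure (return borel (x i)) A))"
    proof (rule countably_additiveI)
      fix B :: "nat \<Rightarrow> 'a set" assume B: "range B \<subseteq> sets borel" "disjoint_family B"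
      have "(\<Sum>n. ennreal (1 / real N) * (\<Sum>i<N. emeasure (return borel (x i)) (B n)))
        = ennreal (1 / real N) * (\<Sum>i<N. \<Sum>n. emeasure (return borel (x i)) (B n))"
        by (subst ennreal_suminf_cmult) (simp add: suminf_sum)
      then show "(\<Sum>n. ennreal (1 / real N) * (\<Sum>i<N. emeasure (return borel (x i)) (B n)))
        = ennreal (1 / real N) * (\<Sum>i<N. emeasure (return borel (x i)) (\<Union> (range B)))"
        using B by (simp add: suminf_emeasure del: emeasure_return)
    qed
  qed (use that in \<open>auto simp: positive_def\<close>)
  have em': "emeasure (empirical N x) A = ennreal (1 / real N * (\<Sum>i<N. measure (return borel (x i)) A))"
    for A
  proof (cases "A \<in> sets borel")
    case True
    have "emeasure (return borel (x i)) A = ennreal (measure (return borel (x i)) A)" for i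
      by (intro finite_measure.emeasure_eq_measure prob_space.finite_measure prob_space_return) simp
    then show ?thesis
      unfolding em[OF True] by (simp add: ennreal_mult[symmetric] sum_nonneg)
  next
    case False
    then show ?thesis by (simp add: emeasure_notin_sets measure_notin_sets)
  qed
  show "empirical N x \<in> finite_borel_measures"
    by (simp add: finite_borel_measures_def finite_measureI em')
  show m: "measure (empirical N x) A = 1 / real N * (\<Sum>i<N. measure (return borel (x i)) A)" for A
    unfolding measure_def[of "empirical N x"] em' by (simp add: sum_nonneg)
  show "measure (empirical N x) UNIV = 1"
    unfolding m using assms by simp
qed

text \<open>Every competitor for \<open>P\<close> and \<open>N + F\<close>, where
  \<open>P - N\<close> is the Jordan decomposition of \<mu> - \<nu>, is also one for \<mu> + \<nu>
  and \<open>F\<close>. The total masses change by at most 2|\<nu>| - |\<open>N\<close>| on the left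
  and |\<open>N\<close>| on the right, so |\<open>N\<close>| drops out and it does not matter how
  much of \<mu> and \<nu> cancels.\<close>

lemma W11_le_signed_W11:
  fixes D :: "'a::topological_space \<Rightarrow> 'a \<Rightarrow> ennreal"
  assumes \<mu>: "\<mu> \<in> finite_borel_measures" and \<nu>: "\<nu> \<in> finite_borel_measures"
    and F: "F \<in> finite_borel_measures"
  shows "W11 D (add_measure \<mu> \<nu>) F
    \<le> signed_W11 D (\<lambda>A. measure \<mu> A - measure \<nu> A) (measure F) + ennreal (2 * measure \<nu> UNIV)"
proof -
  obtain P N where j: "jordan_decomposition (\<lambda>A. measure \<mu> A - measure \<nu> A) P N"
    and P\<mu>: "\<And>A. A \<in> sets borel \<Longrightarrow> measure P A \<le> measure \<mu> A"
    using ex_jordan_decomposition[OF \<mu> \<nu>] by metis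
  from j have P: "P \<in> finite_borel_measures" and N: "N \<in> finite_borel_measures"
    and PN: "\<And>A. A \<in> sets borel \<Longrightarrow> measure \<mu> A - measure \<nu> A = measure P A - measure N A"
    by (auto simp: jordan_decomposition_def)
  have null: "null_measure (borel :: 'a measure) \<in> finite_borel_measures"
    by (auto simp: finite_borel_measures_def intro!: finite_measureI)
  \<comment> \<open>The arguments to which \<open>signed_W11\<close> unfolds; the null measure is
    the negative part of \<open>measure F\<close>.\<close>
  define M1 M2 where "M1 = add_measure P (null_measure borel)" and "M2 = add_measure N F"
  have M1: "M1 \<in> finite_borel_measures" "\<And>A. measure M1 A = measure P A"
    and M2: "M2 \<in> finite_borel_measures" "\<And>A. measure M2 A = measure N A + measure F A"
    unfolding M1_def M2_def using P N F null by (simp_all add: measure_def[of "null_measure _"])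
  define E where "E = add_measure \<mu> \<nu>"
  have E: "E \<in> finite_borel_measures" "\<And>A. measure E A = measure \<mu> A + measure \<nu> A"
    unfolding E_def using \<mu> \<nu> by simp_all
  define n v where "n = measure N UNIV" and "v = measure \<nu> UNIV"
  have nv: "2 * v - n \<ge> 0" "n \<ge> 0"
    using P\<mu>[of UNIV] PN[of UNIV] measure_nonneg[of \<nu> UNIV] measure_nonneg[of N UNIV]
    unfolding n_def v_def by (simp_all del: measure_nonneg)
  have "W11 D E F \<le> total_mass (\<lambda>A. measure M1 A - measure M' A) +
        total_mass (\<lambda>A. measure M2 A - measure N' A) + W1 D M' N' + ennreal (2 * v)"
    if M': "M' \<in> finite_borel_measures" and N': "N' \<in> finite_borel_measures"
      and eq: "emeasure M' UNIV = emeasure N' UNIV" for M' N'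
  proof -
    have "W11 D E F \<le> total_mass (\<lambda>A. measure E A - measure M' A) +
        total_mass (\<lambda>A. measure F A - measure N' A) + W1 D M' N'"
      unfolding W11_def by (rule INF_lower2[of "(M', N')"]) (use that in auto)
    also have "total_mass (\<lambda>A. measure E A - measure M' A)
        \<le> total_mass (\<lambda>A. measure M1 A - measure M' A) + ennreal (2 * v - n)"
    \<comment> \<open>From \<mu> - \<nu> = \<open>P - N\<close> follows \<mu> + \<nu> -
      \<open>P\<close> = 2\<nu> - \<open>N\<close>, which is nonnegative because \<open>P\<close>
      \<le> \<mu> forces \<open>N\<close> \<le> \<nu>.\<close>
    proof (rule total_mass_le_add[OF E(1) M1(1) M', where k = "\<lambda>A. 2 * measure \<nu> A - measure N A"])
      fix A :: "'a set" assume A: "A \<in> sets borel"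
      show "\<bar>measure E A - measure M1 A\<bar> \<le> 2 * measure \<nu> A - measure N A"
        using P\<mu>[OF A] PN[OF A] measure_nonneg[of \<nu> A]
        by (simp add: E M1 del: measure_nonneg)
      show "2 * measure \<nu> A - measure N A + (2 * measure \<nu> (- A) - measure N (- A)) = 2 * v - n"
        using measure_add_Compl[OF N A] measure_add_Compl[OF \<nu> A] by (simp add: n_def v_def)
    qed
    also have "total_mass (\<lambda>A. measure F A - measure N' A)
        \<le> total_mass (\<lambda>A. measure M2 A - measure N' A) + ennreal n"
      by (rule total_mass_le_add[OF F M2(1) N', where k = "measure N"])
        (auto simp: M2 n_def measure_add_Compl[OF N])
    also have "ennreal (2 * v) = ennreal (2 * v - n) + ennreal n"
      using nv by (subst ennreal_plus[symmetric]) auto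
    ultimately show ?thesis by (simp add: add_mono ac_simps)
  qed
  then have "W11 D E F - ennreal (2 * v) \<le> W11 D M1 M2"
    unfolding W11_def[of D M1 M2]
    by (intro INF_greatest) (auto simp: ennreal_minus_le_iff add.commute)
  then show ?thesis
    unfolding signed_W11_def jordan_eq[OF j] jordan_eq[OF jordan_decomposition_measure[OF F]]
      M1_def M2_def E_def v_def
    by (auto simp: ennreal_minus_le_iff add.commute)
qed

text \<open>The two halves are rescaled so that their sum is the empirical measure of all
  \<open>N1 + N2\<close> points; then |\<nu>| = \<open>N2 / (N1 + N2)\<close> is the price of moving
  \<nu> across.\<close>

lemma signed_empirical_W11_ge:
  fixes D :: "'a::topological_space \<Rightarrow> 'a \<Rightarrow> ennreal"
  assumes F: "F \<in> finite_borel_measures" and N: "N1 > 0" "N2 > 0"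
    and ge: "\<And>z. ennreal b \<le> W11 D (empirical (N1 + N2) z) F"
  shows "ereal (b - 2 * real N2 / real (N1 + N2))
    \<le> enn2ereal (signed_W11 D (signed_empirical N1 N2 x y) (measure F))"
proof -
  define \<mu> where "\<mu> = scale_measure (ennreal (real N1 / real (N1 + N2))) (empirical N1 x)"
  define \<nu> where "\<nu> = scale_measure (ennreal (real N2 / real (N1 + N2))) (empirical N2 y)"
  have *: "scale_measure (ennreal k) M \<in> finite_borel_measures"
    if "M \<in> finite_borel_measures" for k and M :: "'a measure"
    using finite_borel_measuresD[OF that]
    by (auto simp: finite_borel_measures_def space_scale_measure ennreal_mult_eq_top_iff
        finite_measure.emeasure_finite intro!: finite_measureI)
  have \<mu>: "\<mu> \<in> finite_borel_measures"
    "\<And>A. measure \<mu> A = 1 / real (N1 + N2) * (\<Sum>i<N1. measure (return borel (x i)) A)"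
    unfolding \<mu>_def using N by (auto intro!: * empirical_finite simp: measure_empirical)
  have \<nu>: "\<nu> \<in> finite_borel_measures"
    "\<And>A. measure \<nu> A = 1 / real (N1 + N2) * (\<Sum>i<N2. measure (return borel (y i)) A)"
    "measure \<nu> UNIV = real N2 / real (N1 + N2)"
    unfolding \<nu>_def using N
    by (auto intro!: * empirical_finite simp: measure_empirical measure_empirical[symmetric] empirical_UNIV)
  \<comment> \<open>Concatenation of the two families of points.\<close>
  define z where "z i = (if i < N1 then x i else y (i - N1))" for i
  have split: "(\<Sum>i<N1 + n. f (z i)) = (\<Sum>i<N1. f (x i)) + (\<Sum>i<n. f (y i))" for n and f :: "'a \<Rightarrow> real"
    by (induction n) (auto simp: z_def)
  have "empirical (N1 + N2) z = add_measure \<mu> \<nu>"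
    using \<mu> \<nu> N
    by (intro finite_borel_measures_eqI)
      (auto intro!: empirical_finite simp: measure_empirical split[where f = "\<lambda>p. measure (return borel p) _"] distrib_left)
  moreover have "signed_empirical N1 N2 x y = (\<lambda>A. measure \<mu> A - measure \<nu> A)"
    by (rule ext) (simp add: signed_empirical_def \<mu> \<nu> right_diff_distrib)
  ultimately have "ennreal b \<le> signed_W11 D (signed_empirical N1 N2 x y) (measure F)
      + ennreal (2 * real N2 / real (N1 + N2))"
    using ge[of z] W11_le_signed_W11[OF \<mu>(1) \<nu>(1) F, of D] \<nu>(3) by auto
  then have "ennreal (b - 2 * real N2 / real (N1 + N2)) \<le> signed_W11 D (signed_empirical N1 N2 x y) (measure F)"
    by (subst ennreal_minus[symmetric]) (auto simp: ennreal_minus_le_iff add.commute)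
  then have "enn2ereal (ennreal (b - 2 * real N2 / real (N1 + N2)))
     \<le> enn2ereal (signed_W11 D (signed_empirical N1 N2 x y) (measure F))"
    by (simp add: less_eq_ennreal.rep_eq)
  \<comment> \<open>\<open>ennreal\<close> truncates a negative bound to 0, but in
    \<open>ereal\<close> such a bound lies below the nonnegative right side anyway.\<close>
  then show ?thesis
    by (metis enn2ereal_nonneg enn2ereal_ennreal ereal_less_eq(3) ereal_less_eq(5) linear order_trans)
qed

section \<open>Couplings\<close>

lemma emeasure_coupling:
  assumes "\<pi> \<in> couplings M N"
  shows "A \<in> sets borel \<Longrightarrow> emeasure \<pi> (A \<times> UNIV) = emeasure M A"
    and "A \<in> sets borel \<Longrightarrow> emeasure \<pi> (UNIV \<times> A) = emeasure N A"
proof -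
  have s: "sets \<pi> = sets (borel \<Otimes>\<^sub>M borel)" "distr \<pi> borel fst = M" "distr \<pi> borel snd = N"
    using assms by (auto simp: couplings_def)
  then have [simp]: "space \<pi> = UNIV" using sets_eq_imp_space_eq[OF s(1)] by (simp add: space_pair_measure)
  have [measurable]: "fst \<in> measurable \<pi> borel" "snd \<in> measurable \<pi> borel"
    by (simp_all cong: measurable_cong_sets add: s(1))
  show "emeasure \<pi> (A \<times> UNIV) = emeasure M A" if "A \<in> sets borel"
    using that by (subst s(2)[symmetric]) (auto simp: emeasure_distr intro!: arg_cong[where f = "emeasure \<pi>"])
  show "emeasure \<pi> (UNIV \<times> A) = emeasure N A" if "A \<in> sets borel"
    using that by (subst s(3)[symmetric]) (auto simp: emeasure_distr intro!: arg_cong[where f = "emeasure \<pi>"])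
qed

text \<open>\<open>E\<close> lives on \<open>A\<close>, and at least half of \<open>F\<close> lies
  outside \<open>U\<close>, at distance at least \<open>r\<close> from \<open>A\<close>. If a
  competitor carries mass \<open>v\<close> from \<open>A\<close> to the complement of
  \<open>U\<close>, the removed mass is at least \<open>1 - 2 * v\<close> and the transport costs at
  least \<open>r * v\<close>. For \<open>r \<le> 2\<close> the sum is smallest at
  \<open>v = 1/2\<close>, where it is \<open>r / 2\<close>.\<close>

lemma W11_ge_separated:
  fixes D :: "'a::topological_space \<Rightarrow> 'a \<Rightarrow> ennreal"
  assumes E: "E \<in> finite_borel_measures" "measure E UNIV = 1"
    and F: "F \<in> finite_borel_measures" "measure F UNIV = 1"
    and A: "A \<in> sets borel" "measure E (- A) = 0" and U: "U \<in> sets borel" "measure F U \<le> 1 / 2"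
    and r: "0 \<le> r" "r \<le> 2" and sep: "\<And>p q. p \<in> A \<Longrightarrow> q \<notin> U \<Longrightarrow> ennreal r \<le> D p q"
  shows "ennreal (r / 2) \<le> W11 D E F"
proof -
  have "ennreal (r / 2) \<le> total_mass (\<lambda>A. measure E A - measure M A) +
        total_mass (\<lambda>A. measure F A - measure N A) + (\<integral>\<^sup>+z. D (fst z) (snd z) \<partial>\<pi>)"
    if M: "M \<in> finite_borel_measures" and N: "N \<in> finite_borel_measures"
      and eq: "emeasure M UNIV = emeasure N UNIV" and \<pi>: "\<pi> \<in> couplings M N" for M N \<pi>
  proof -
    have s: "sets \<pi> = sets (borel \<Otimes>\<^sub>M borel)" and fin: "finite_measure \<pi>"
      using \<pi> by (auto simp: couplings_def)
    have sp [simp]: "space \<pi> = UNIV" using sets_eq_imp_space_eq[OF s(1)] by (simp add: space_pair_measure)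
    note em = emeasure_coupling[OF \<pi>]
    have mA: "measure \<pi> (B \<times> UNIV) = measure M B" "measure \<pi> (UNIV \<times> B) = measure N B"
      if "B \<in> sets borel" for B using em[OF that] by (simp_all add: measure_def)
    have meas: "B \<times> C \<in> sets \<pi>" if "B \<in> sets borel" "C \<in> sets borel" for B C
      using that by (simp add: s)
    define m a n where "m = measure M UNIV" and "a = measure M (- A)" and "n = measure N U"
    have m: "measure N UNIV = m" using eq by (simp add: m_def measure_def)
    \<comment> \<open>The total mass less what starts outside \<open>A\<close> and what ends in
      \<open>U\<close>. It can be negative, hence \<open>max 0 v\<close> below.\<close>
    define v where "v = m - a - n"
    have "measure M UNIV = measure \<pi> UNIV" using mA(1)[of UNIV] by simp
    also have "\<dots> = measure \<pi> ((A \<times> - U) \<union> ((- A) \<times> UNIV) \<union> (UNIV \<times> U))"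
      by (rule arg_cong[where f = "measure \<pi>"]) auto
    also have "\<dots> \<le> measure \<pi> (A \<times> - U) + measure \<pi> ((- A) \<times> UNIV) + measure \<pi> (UNIV \<times> U)"
      using A U meas
      by (intro order_trans[OF measure_Un_le] add_right_mono measure_Un_le) (auto intro!: sets.Un)
    finally have v: "v \<le> measure \<pi> (A \<times> - U)"
      using A U mA(1)[of "- A"] mA(2)[of U] by (simp add: v_def m_def a_def n_def)
    have "ennreal (r * max 0 v) \<le> ennreal (r * measure \<pi> (A \<times> - U))"
      using v r by (intro ennreal_leI mult_left_mono) auto
    also have "\<dots> = (\<integral>\<^sup>+z. ennreal r * indicator (A \<times> - U) z \<partial>\<pi>)"
      using A U meas[of A "- U"] fin r
      by (simp add: nn_integral_cmult_indicator finite_measure.emeasure_eq_measure ennreal_mult)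
    also have "\<dots> \<le> (\<integral>\<^sup>+z. D (fst z) (snd z) \<partial>\<pi>)"
      using sep by (intro nn_integral_mono) (auto split: split_indicator)
    finally have I: "ennreal (r * max 0 v) \<le> (\<integral>\<^sup>+z. D (fst z) (snd z) \<partial>\<pi>)" .
    have t1: "ennreal (1 - m + 2 * a) \<le> total_mass (\<lambda>A. measure E A - measure M A)"
    proof -
      have "1 - m + 2 * a = (measure E A - measure M A) - (measure E (- A) - measure M (- A))"
        using measure_add_Compl[OF E(1) A(1)] measure_add_Compl[OF M A(1)] E(2) A(2) by (simp add: m_def a_def)
      then show ?thesis using total_mass_ge[OF E(1) M A(1)] by simp
    qed
    have t2: "ennreal (2 * n - m) \<le> total_mass (\<lambda>A. measure F A - measure N A)"
    proof -
      have "- U \<in> sets borel" using U by auto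
      from total_mass_ge[OF F(1) N this]
      have "ennreal ((1 - measure F U - (m - n)) - (measure F U - n)) \<le> total_mass (\<lambda>A. measure F A - measure N A)"
        using measure_add_Compl[OF F(1) U(1)] measure_add_Compl[OF N U(1)] F(2)
        by (elim order_trans[rotated]) (intro ennreal_leI, simp add: m n_def)
      \<comment> \<open>The expression tested on \<open>- U\<close> is \<open>2 * n - m\<close> plus
        \<open>1 - 2 * measure F U\<close>, and the latter is nonnegative.\<close>
      then show ?thesis using U(2) by (elim order_trans[rotated]) (intro ennreal_leI, simp)
    qed
    have "r / 2 \<le> max 0 (1 - m + 2 * a) + max 0 (2 * n - m) + r * max 0 v"
    proof (cases "v \<ge> 1 / 2")
      case True
      then have "r / 2 \<le> r * max 0 v" using r mult_left_mono[of "1/2" "max 0 v" r] by simp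
      then show ?thesis by linarith
    next
      case False
      have "r / 2 \<le> 1 - 2 * v + r * max 0 v"
      proof (cases "v \<ge> 0")
        case True
        have "(2 - r) * v \<le> (2 - r) * (1 / 2)"
          using False r by (intro mult_left_mono) auto
        then show ?thesis using True by (simp add: algebra_simps)
      qed (use r in simp)
      moreover have "1 - 2 * v = (1 - m + 2 * a) + (2 * n - m)" by (simp add: v_def)
      ultimately show ?thesis by linarith
    qed
    then have "ennreal (r / 2) \<le> ennreal (max 0 (1 - m + 2 * a) + max 0 (2 * n - m) + r * max 0 v)"
      by (rule ennreal_leI)
    also have "\<dots> = ennreal (1 - m + 2 * a) + ennreal (2 * n - m) + ennreal (r * max 0 v)"
      using r by (simp add: ennreal_plus)
    finally show ?thesis using t1 t2 I by (meson add_mono order_trans)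
  qed
  then show ?thesis by (rule W11_greatest[OF E(1) F(1)])
qed

text \<open>The function \<open>h\<close> need not be measurable: its integral is then a lower integral, which is not
  additive in the measure, but the inequality survives because \<open>h\<close> is approximated from below.\<close>

lemma nn_integral_add_measure_le:
  assumes M: "sets M = sets borel" and N: "sets N = sets borel" and L: "sets L = sets borel"
    and le: "\<And>A. emeasure M A \<le> emeasure L A" and h: "\<And>x. h x \<le> C"
  shows "(\<integral>\<^sup>+x. h x \<partial>add_measure M N) \<le> (\<integral>\<^sup>+x. h x \<partial>L) + C * emeasure N UNIV"
proof -
  note [simp] = sets_eq_imp_space_eq[OF M] sets_eq_imp_space_eq[OF N] sets_eq_imp_space_eq[OF L]
  have "integral\<^sup>S (add_measure M N) s \<le> (\<integral>\<^sup>+x. h x \<partial>L) + C * emeasure N UNIV"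
    if s: "simple_function (add_measure M N) s" "s \<le> h" for s
  proof -
    have sN: "simple_function N s" and sL: "simple_function L s"
      using s(1) M N L by (auto simp: simple_function_def)
    have "integral\<^sup>S (add_measure M N) s
        = (\<Sum>x\<in>range s. x * emeasure M (s -` {x})) + (\<Sum>x\<in>range s. x * emeasure N (s -` {x}))"
      unfolding simple_integral_def
      by (simp add: emeasure_add_measure[OF M N] distrib_left sum.distrib)
    also have "\<dots> \<le> integral\<^sup>S L s + integral\<^sup>S N s"
      unfolding simple_integral_def by (auto intro!: add_mono sum_mono mult_left_mono le)
    also have "\<dots> = (\<integral>\<^sup>+x. s x \<partial>L) + (\<integral>\<^sup>+x. s x \<partial>N)"
      by (simp add: nn_integral_eq_simple_integral sN sL)
    also have "\<dots> \<le> (\<integral>\<^sup>+x. h x \<partial>L) + (\<integral>\<^sup>+x. C \<partial>N)"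
      using s(2) h by (intro add_mono nn_integral_mono) (auto simp: le_fun_def intro: order_trans)
    finally show ?thesis by simp
  qed
  then show ?thesis
    unfolding nn_integral_def[of "add_measure M N"] by (intro SUP_least) auto
qed

text \<open>The minimum of \<open>P\<close> and the marginal \<open>M\<close> of \<pi> has a density
  \<open>a \<le> 1\<close> with respect to \<open>M\<close>; weighting \<pi> by \<open>a\<close>
  composed with \<open>f\<close> cuts its marginal down to that minimum. The lost mass is that of
  the positive part of \<open>M - P\<close>. It is expressed through the Hahn set \<open>H\<close>
  so that total masses can be tested on the same set.\<close>

lemma ex_submeasure_distr_le:
  fixes f :: "'b \<Rightarrow> 'a::topological_space"
  assumes fin: "finite_measure \<pi>" and f [measurable]: "f \<in> measurable \<pi> borel"
    and P: "P \<in> finite_borel_measures"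
  obtains \<pi>' H where "sets \<pi>' = sets \<pi>" "finite_measure \<pi>'"
    "\<And>A. emeasure \<pi>' A \<le> emeasure \<pi> A"
    "\<And>A. A \<in> sets borel \<Longrightarrow> emeasure (distr \<pi>' borel f) A \<le> emeasure P A"
    "H \<in> sets borel"
    "measure \<pi>' (space \<pi>) = measure \<pi> (space \<pi>) - (measure (distr \<pi> borel f) H - measure P H)"
proof -
  define M where "M = distr \<pi> borel f"
  have M: "M \<in> finite_borel_measures"
    unfolding M_def finite_borel_measures_def using finite_measure.finite_measure_distr[OF fin f] by simp
  note dM = finite_borel_measuresD[OF M] and dP = finite_borel_measuresD[OF P]
  have fM [simp]: "finite_measure M" and [simp, measurable_cong]: "sets M = sets borel"
    and [simp]: "space M = UNIV" by (fact dM)+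
  obtain J K H where j: "jordan_decomposition (\<lambda>A. measure M A - measure P A) J K"
    and H: "H \<in> sets borel" "measure J (- H) = 0" "measure K H = 0"
    and JM: "\<And>A. A \<in> sets borel \<Longrightarrow> measure J A \<le> measure M A"
    using ex_jordan_decomposition[OF M P] by metis
  have J: "J \<in> finite_borel_measures" and K: "K \<in> finite_borel_measures"
    and JK: "\<And>A. A \<in> sets borel \<Longrightarrow> measure M A - measure P A = measure J A - measure K A"
    using j by (auto simp: jordan_decomposition_def)
  note dJ = finite_borel_measuresD[OF J]
  have JMe: "emeasure J A \<le> emeasure M A" if "A \<in> sets borel" for A
    using JM[OF that] dM dJ by (simp add: finite_measure.emeasure_eq_measure)
  \<comment> \<open>\<open>J\<close> is the positive part of \<open>M - P\<close>, so \<open>P0\<close> is the minimum of \<open>M\<close> and \<open>P\<close>.\<close>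
  define P0 where "P0 = diff_measure M J"
  have P0: "emeasure P0 A = ennreal (measure M A - measure J A)" if "A \<in> sets borel" for A
    unfolding P0_def using dM dJ JMe that
    by (subst emeasure_diff_measure) (auto simp: finite_measure.emeasure_eq_measure ennreal_minus)
  have [simp]: "sets P0 = sets borel" "space P0 = UNIV" by (simp_all add: P0_def)
  have P0M: "emeasure P0 A \<le> emeasure M A" if "A \<in> sets borel" for A
    unfolding P0[OF that] using dM by (simp add: finite_measure.emeasure_eq_measure ennreal_leI)
  have P0P: "emeasure P0 A \<le> emeasure P A" if "A \<in> sets borel" for A
    unfolding P0[OF that] using dP JK[OF that] measure_nonneg[of K A]
    by (simp add: finite_measure.emeasure_eq_measure ennreal_leI del: measure_nonneg)
  have "finite_measure P0" using P0[of UNIV] by (intro finite_measureI) simp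
  moreover have "absolutely_continuous M P0"
    unfolding absolutely_continuous_def
  proof
    fix X assume "X \<in> null_sets M"
    then show "X \<in> null_sets P0" using P0M[of X] by (auto simp: null_sets_def)
  qed
  ultimately obtain a where a: "a \<in> borel_measurable M" "density M a = P0"
    using finite_measure.Radon_Nikodym_finite_measure[OF fM, of P0] by auto
  have [measurable]: "a \<in> borel_measurable borel" using a(1) by (simp cong: measurable_cong_sets)
  \<comment> \<open>On \<open>B\<close>, where \<open>a\<close> exceeds 1, the integral of
    \<open>a - 1\<close> is the excess of \<open>P0 B\<close> over \<open>M B\<close>. Domination
    makes it zero, since the finite \<open>M B\<close> can be cancelled.\<close>
  have ae: "AE x in M. a x \<le> 1"
  proof -
    define B where "B = {x. 1 < a x}"
    have [measurable]: "B \<in> sets borel" unfolding B_def by simp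
    have "emeasure P0 B = (\<integral>\<^sup>+x. a x * indicator B x \<partial>M)"
      using a by (simp add: a(2)[symmetric] emeasure_density)
    also have "\<dots> = (\<integral>\<^sup>+x. (a x - 1) * indicator B x + indicator B x \<partial>M)"
      by (intro nn_integral_cong) (auto simp: B_def diff_add_cancel_ennreal split: split_indicator)
    also have "\<dots> = (\<integral>\<^sup>+x. (a x - 1) * indicator B x \<partial>M) + emeasure M B"
      using a(1) by (subst nn_integral_add) auto
    finally have "(\<integral>\<^sup>+x. (a x - 1) * indicator B x \<partial>M) + emeasure M B \<le> 0 + emeasure M B"
      using P0M[of B] by simp
    then have "(\<integral>\<^sup>+x. (a x - 1) * indicator B x \<partial>M) \<le> 0"
      using finite_measure.emeasure_finite[OF fM, of B]
      by (simp only: add.commute[of _ "emeasure M B"] ennreal_add_left_cancel_le) simp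
    then have "AE x in M. (a x - 1) * indicator B x = 0"
      using a(1) by (subst (asm) le_zero_eq, subst (asm) nn_integral_0_iff_AE) auto
    then show ?thesis
      by (rule AE_mp) (auto simp: B_def not_less[symmetric] dest: ennreal_minus_eq_0 split: split_indicator intro!: AE_I2)
  qed
  define \<pi>' where "\<pi>' = density \<pi> (\<lambda>z. a (f z))"
  have s' [simp]: "sets \<pi>' = sets \<pi>" "space \<pi>' = space \<pi>" by (simp_all add: \<pi>'_def)
  have le: "emeasure \<pi>' A \<le> emeasure \<pi> A" for A
  proof (cases "A \<in> sets \<pi>")
    case True
    have "AE z in \<pi>. a (f z) \<le> 1" using ae unfolding M_def by (rule AE_distrD[OF f])
    then have "(\<integral>\<^sup>+z. a (f z) * indicator A z \<partial>\<pi>) \<le> (\<integral>\<^sup>+z. indicator A z \<partial>\<pi>)"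
      by (intro nn_integral_mono_AE) (erule AE_mp, auto intro!: AE_I2 split: split_indicator)
    then show ?thesis using True by (simp add: \<pi>'_def emeasure_density)
  qed (simp add: emeasure_notin_sets)
  have d: "emeasure \<pi>' (f -` A \<inter> space \<pi>) = emeasure P0 A" if "A \<in> sets borel" for A
  proof -
    have "emeasure \<pi>' (f -` A \<inter> space \<pi>) = (\<integral>\<^sup>+z. a (f z) * indicator A (f z) \<partial>\<pi>)"
      using that measurable_sets[OF f that]
      by (auto simp: \<pi>'_def emeasure_density intro!: nn_integral_cong split: split_indicator)
    also have "\<dots> = (\<integral>\<^sup>+x. a x * indicator A x \<partial>M)"
      unfolding M_def using that by (subst nn_integral_distr) auto
    also have "\<dots> = emeasure P0 A"
      using a that by (simp add: a(2)[symmetric] emeasure_density)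
    finally show ?thesis .
  qed
  have fin': "finite_measure \<pi>'"
    using le[of "space \<pi>"] finite_measure.emeasure_finite[OF fin] by (intro finite_measureI) (auto simp: top_unique)
  have f' [measurable]: "f \<in> measurable \<pi>' borel" by (simp add: \<pi>'_def)
  have "measure \<pi>' (space \<pi>) = measure M UNIV - measure J UNIV"
    using d[of UNIV] P0[of UNIV] JM[of UNIV] by (simp add: measure_def)
  moreover have "measure M UNIV = measure \<pi> (space \<pi>)"
    unfolding M_def by (simp add: measure_distr)
  moreover have "measure J UNIV = measure J H + measure J (- H)"
    using dJ H by (subst finite_measure.finite_measure_Union[symmetric]) auto
  ultimately have "measure \<pi>' (space \<pi>) = measure \<pi> (space \<pi>) - (measure M H - measure P H)"
    using JK[OF H(1)] H by simp
  moreover have "emeasure (distr \<pi>' borel f) A \<le> emeasure P A" if "A \<in> sets borel" for A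
    using d[OF that] P0P[OF that] that by (simp add: emeasure_distr)
  ultimately show ?thesis
    using that[of \<pi>' H] fin' le H(1) unfolding M_def by simp
qed

text \<open>\<open>total_mass_ge\<close> tested on \<open>- H\<close>, rearranged to show the excess
  of \<open>M\<close> over \<open>E\<close> on \<open>H\<close>, which is the mass lost when a
  coupling is cut down.\<close>

lemma measure_diff_le_total_mass:
  assumes E: "E \<in> finite_borel_measures" and M: "M \<in> finite_borel_measures" and H: "H \<in> sets borel"
  shows "ennreal (measure E UNIV - measure M UNIV + 2 * (measure M H - measure E H))
    \<le> total_mass (\<lambda>A. measure E A - measure M A)"
proof -
  have "- H \<in> sets borel" using H by auto
  from total_mass_ge[OF E M this] show ?thesis
    by (elim order_trans[rotated])
      (intro ennreal_leI, use measure_add_Compl[OF E H] measure_add_Compl[OF M H] in simp)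
qed

text \<open>A competing coupling is cut down to first marginal below \<open>E\<close>, then to
  second marginal below \<open>F\<close>. If mass \<open>k\<close> is then missing, completing the
  plan costs at most \<open>2 * k\<close>, and the total masses already paid at least that.
  Measurability of \<open>D\<close> is not assumed.\<close>

lemma W1_le_W11:
  fixes D :: "'a::second_countable_topology \<Rightarrow> 'a \<Rightarrow> ennreal"
  assumes E: "E \<in> finite_borel_measures" "measure E UNIV = 1"
    and F: "F \<in> finite_borel_measures" "measure F UNIV = 1"
    and D: "\<And>p q. D p q \<le> 2"
  shows "W1 D E F \<le> W11 D E F"
proof -
  have "W1 D E F \<le> total_mass (\<lambda>A. measure E A - measure M A) +
        total_mass (\<lambda>A. measure F A - measure N A) + (\<integral>\<^sup>+z. D (fst z) (snd z) \<partial>\<pi>)"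
    if M: "M \<in> finite_borel_measures" and N: "N \<in> finite_borel_measures"
      and eq: "emeasure M UNIV = emeasure N UNIV" and \<pi>: "\<pi> \<in> couplings M N" for M N \<pi>
  proof -
    \<comment> \<open>By \<open>borel_prod\<close>, which uses second countability, the product
      \<sigma>-algebra is the Borel one, on which \<open>add_measure\<close> is defined.\<close>
    have s: "sets \<pi> = sets borel" and fin: "finite_measure \<pi>" 
      and marg: "distr \<pi> borel fst = M" "distr \<pi> borel snd = N"
      using \<pi> unfolding couplings_def mem_Collect_eq borel_prod by blast+
    have sp [simp]: "space \<pi> = UNIV" using sets_eq_imp_space_eq[OF s] by simp
    have fst_m: "fst \<in> measurable \<kappa> borel" and snd_m: "snd \<in> measurable \<kappa> borel"
      if "sets \<kappa> = sets borel" for \<kappa> :: "('a \<times> 'a) measure"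
      using that borel_measurable_continuous_onI[OF continuous_on_fst[OF continuous_on_id]]
        borel_measurable_continuous_onI[OF continuous_on_snd[OF continuous_on_id]]
      by (simp_all cong: measurable_cong_sets)
    obtain \<pi>1 H1 where 1: "sets \<pi>1 = sets \<pi>" "finite_measure \<pi>1"
      "\<And>A. emeasure \<pi>1 A \<le> emeasure \<pi> A"
      "\<And>A. A \<in> sets borel \<Longrightarrow> emeasure (distr \<pi>1 borel fst) A \<le> emeasure E A"
      "H1 \<in> sets borel" "measure \<pi>1 UNIV = measure \<pi> UNIV - (measure M H1 - measure E H1)"
      using ex_submeasure_distr_le[OF fin fst_m[OF s] E(1)] unfolding marg sp by metis
    have s1: "sets \<pi>1 = sets borel" using 1 s by simp
    have sp1 [simp]: "space \<pi>1 = UNIV" using sets_eq_imp_space_eq[OF s1] by simp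
    obtain \<pi>2 H2 where 2: "sets \<pi>2 = sets \<pi>1" "finite_measure \<pi>2"
      "\<And>A. emeasure \<pi>2 A \<le> emeasure \<pi>1 A"
      "\<And>A. A \<in> sets borel \<Longrightarrow> emeasure (distr \<pi>2 borel snd) A \<le> emeasure F A"
      "H2 \<in> sets borel"
      "measure \<pi>2 UNIV = measure \<pi>1 UNIV - (measure (distr \<pi>1 borel snd) H2 - measure F H2)"
      using ex_submeasure_distr_le[OF 1(2) snd_m[OF s1] F(1)] unfolding sp1 by metis
    have s2: "sets \<pi>2 = sets borel" using 2 s1 by simp
    have sp2 [simp]: "space \<pi>2 = UNIV" using sets_eq_imp_space_eq[OF s2] by simp
    define P Q where "P = distr \<pi>2 borel fst" and "Q = distr \<pi>2 borel snd"
    have P: "P \<in> finite_borel_measures" "\<And>A. A \<in> sets borel \<Longrightarrow> emeasure P A \<le> emeasure E A"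
      and Q: "Q \<in> finite_borel_measures" "\<And>A. A \<in> sets borel \<Longrightarrow> emeasure Q A \<le> emeasure F A"
    proof -
      show "P \<in> finite_borel_measures" "Q \<in> finite_borel_measures"
        unfolding P_def Q_def finite_borel_measures_def
        using finite_measure.finite_measure_distr[OF 2(2) fst_m[OF s2]]
          finite_measure.finite_measure_distr[OF 2(2) snd_m[OF s2]] by simp_all
      show "emeasure Q A \<le> emeasure F A" if "A \<in> sets borel" for A
        using 2(4)[OF that] by (simp add: Q_def)
      show "emeasure P A \<le> emeasure E A" if "A \<in> sets borel" for A
        using 1(4)[OF that] 2(3)[of "fst -` A"] that
        by (simp add: P_def emeasure_distr fst_m s1 s2) 
    qed
    have PU: "measure P UNIV = measure \<pi>2 UNIV" "measure Q UNIV = measure \<pi>2 UNIV"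
      unfolding P_def Q_def by (simp_all add: measure_distr fst_m snd_m s2)
    define m m1 m2 k where "m = measure \<pi> UNIV" and "m1 = measure \<pi>1 UNIV"
      and "m2 = measure \<pi>2 UNIV" and "k = 1 - m2"
    have mM: "measure M UNIV = m" "measure N UNIV = m"
      unfolding m_def marg[symmetric] by (simp_all add: measure_distr fst_m snd_m s)
    have "emeasure P UNIV \<le> emeasure E UNIV" using P(2) by simp
    then have k: "k \<ge> 0"
      using finite_borel_measuresD(3)[OF P(1)] finite_borel_measuresD(3)[OF E(1)] E(2) PU
      by (simp add: k_def m2_def finite_measure.emeasure_eq_measure)
    \<comment> \<open>The first cut can only lower the second marginal, so the loss in the second
      cut is bounded by the excess of \<open>N\<close> itself over \<open>F\<close>.\<close>
    have "measure (distr \<pi>1 borel snd) H2 \<le> measure (distr \<pi> borel snd) H2"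
      using 1(3)[of "snd -` H2"] 2(5) fin 1(2)
      by (simp add: measure_distr snd_m s s1 finite_measure.emeasure_eq_measure)
    then have k2: "2 * k \<le> (1 - m + 2 * (measure M H1 - measure E H1)) + (1 - m + 2 * (measure N H2 - measure F H2))"
      using 1(6) 2(6) unfolding marg by (simp add: k_def m_def m2_def m1_def)
    have T: "ennreal (2 * k) \<le> total_mass (\<lambda>A. measure E A - measure M A) +
        total_mass (\<lambda>A. measure F A - measure N A)"
    proof -
      have "ennreal (2 * k) \<le> ennreal (1 - m + 2 * (measure M H1 - measure E H1))
          + ennreal (1 - m + 2 * (measure N H2 - measure F H2))"
        using k2 k by (simp add: ennreal_plus_if ennreal_leI)
      also have "\<dots> \<le> total_mass (\<lambda>A. measure E A - measure M A) +
        total_mass (\<lambda>A. measure F A - measure N A)"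
        using measure_diff_le_total_mass[OF E(1) M 1(5)] measure_diff_le_total_mass[OF F(1) N 2(5)]
        by (intro add_mono) (simp_all add: mM E F)
      finally show ?thesis .
    qed
    \<comment> \<open>The deficits of the two marginals, both of mass \<open>k\<close>; their
      product divided by \<open>k\<close> has exactly these marginals.\<close>
    define R1 R2 where "R1 = diff_measure E P" and "R2 = diff_measure F Q"
    have R: "emeasure (diff_measure A B) X = emeasure A X - emeasure B X"
      "emeasure B X + (emeasure A X - emeasure B X) = emeasure A X"
      "emeasure (diff_measure A B) UNIV = ennreal (measure A UNIV - measure B UNIV)"
      "finite_measure (diff_measure A B)" "sets (diff_measure A B) = sets borel"
      if "A \<in> finite_borel_measures" "B \<in> finite_borel_measures"
        "\<And>X. X \<in> sets borel \<Longrightarrow> emeasure B X \<le> emeasure A X" "X \<in> sets borel"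
      for A B and X :: "'a set"
    proof -
      note d = finite_borel_measuresD[OF that(1)] finite_borel_measuresD[OF that(2)]
      have *: "emeasure (diff_measure A B) X = emeasure A X - emeasure B X" if "X \<in> sets borel" for X
        using d that \<open>\<And>X. X \<in> sets borel \<Longrightarrow> emeasure B X \<le> emeasure A X\<close>
        by (intro emeasure_diff_measure) auto
      show "emeasure (diff_measure A B) X = emeasure A X - emeasure B X" using * that by simp
      show "emeasure B X + (emeasure A X - emeasure B X) = emeasure A X"
        using that by (intro add_diff_inverse_ennreal) auto
      show U: "emeasure (diff_measure A B) UNIV = ennreal (measure A UNIV - measure B UNIV)"
        using d by (simp add: * finite_measure.emeasure_eq_measure ennreal_minus)
      show "finite_measure (diff_measure A B)" "sets (diff_measure A B) = sets borel"
        using U d by (auto intro!: finite_measureI)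
    qed
    note RE = R[OF E(1) P(1) P(2)] and RF = R[OF F(1) Q(1) Q(2)]
    have fR: "finite_measure R1" "finite_measure R2" "sets R1 = sets borel" "sets R2 = sets borel"
      "emeasure R1 UNIV = ennreal k" "emeasure R2 UNIV = ennreal k"
      unfolding R1_def R2_def using RE(3-5)[of UNIV] RF(3-5)[of UNIV] E(2) F(2) PU
      by (simp_all add: k_def m2_def)
    interpret R2: finite_measure R2 by (fact fR)
    define \<rho> where "\<rho> = scale_measure (ennreal (inverse k)) (R1 \<Otimes>\<^sub>M R2)"
    have s\<rho>: "sets \<rho> = sets borel"
      unfolding \<rho>_def by (simp add: borel_prod[symmetric] sets_pair_measure_cong[OF fR(3,4)])
    \<comment> \<open>For \<open>k = 0\<close> the convention \<open>inverse 0 = 0\<close> is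
      harmless, as both deficits vanish.\<close>
    have cancel: "ennreal (inverse k) * (x * ennreal k) = x" if "x \<le> ennreal k" for x
    proof (cases "k = 0")
      case True then show ?thesis using that by simp
    next
      case False
      then have "ennreal (inverse k) * ennreal k = 1"
        using k by (simp flip: ennreal_mult ennreal_1)
      then show ?thesis by (simp add: mult.left_commute)
    qed
    have le_k: "emeasure R1 X \<le> ennreal k" "emeasure R2 X \<le> ennreal k" for X
      using emeasure_space[of R1 X] emeasure_space[of R2 X]
        sets_eq_imp_space_eq[OF fR(3)] sets_eq_imp_space_eq[OF fR(4)]
      by (simp_all add: fR(5,6))
    have \<rho>1: "emeasure \<rho> (X \<times> UNIV) = emeasure R1 X" and \<rho>2: "emeasure \<rho> (UNIV \<times> X) = emeasure R2 X"
      if "X \<in> sets borel" for X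
    proof -
      have "X \<in> sets R1" "UNIV \<in> sets R1" "X \<in> sets R2" "UNIV \<in> sets R2" using that fR by simp_all
      then show "emeasure \<rho> (X \<times> UNIV) = emeasure R1 X" "emeasure \<rho> (UNIV \<times> X) = emeasure R2 X"
        using cancel[OF le_k(1)] cancel[OF le_k(2)]
        by (simp_all add: \<rho>_def R2.emeasure_pair_measure_Times fR mult.commute)
    qed
    define \<sigma> where "\<sigma> = add_measure \<pi>2 \<rho>"
    have em\<sigma>: "emeasure \<sigma> X = emeasure \<pi>2 X + emeasure \<rho> X" for X
      unfolding \<sigma>_def by (rule emeasure_add_measure[OF s2 s\<rho>])
    have ss: "sets \<sigma> = sets borel" and sps: "space \<sigma> = UNIV" by (simp_all add: \<sigma>_def)
    have \<rho>U: "emeasure \<rho> UNIV = ennreal k" using \<rho>1[of UNIV] fR by simp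
    have "\<sigma> \<in> couplings E F"
      unfolding couplings_def
    proof (intro CollectI conjI)
      show "sets \<sigma> = sets (borel \<Otimes>\<^sub>M borel)" unfolding borel_prod by (fact ss)
      show "finite_measure \<sigma>"
        using finite_measure.emeasure_finite[OF 2(2), of UNIV] \<rho>U by (intro finite_measureI) (simp add: sps em\<sigma>)
      show "distr \<sigma> borel fst = E"
      proof (rule measure_eqI)
        fix X assume "X \<in> sets (distr \<sigma> borel fst)"
        then have X: "X \<in> sets borel" by simp
        have v: "fst -` X = X \<times> (UNIV :: 'a set)" by auto
        have "emeasure (distr \<sigma> borel fst) X = emeasure P X + emeasure R1 X"
          using X by (simp add: emeasure_distr fst_m ss sps em\<sigma> P_def s2 \<rho>1 v)
        then show "emeasure (distr \<sigma> borel fst) X = emeasure E X"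
          using RE(1,2)[OF _ X] by (simp add: R1_def)
      qed (use finite_borel_measuresD[OF E(1)] in simp)
      show "distr \<sigma> borel snd = F"
      proof (rule measure_eqI)
        fix X assume "X \<in> sets (distr \<sigma> borel snd)"
        then have X: "X \<in> sets borel" by simp
        have v: "snd -` X = (UNIV :: 'a set) \<times> X" by auto
        have "emeasure (distr \<sigma> borel snd) X = emeasure Q X + emeasure R2 X"
          using X by (simp add: emeasure_distr snd_m ss sps em\<sigma> Q_def s2 \<rho>2 v)
        then show "emeasure (distr \<sigma> borel snd) X = emeasure F X"
          using RF(1,2)[OF _ X] by (simp add: R2_def)
      qed (use finite_borel_measuresD[OF F(1)] in simp)
    qed
    then have "W1 D E F \<le> (\<integral>\<^sup>+z. D (fst z) (snd z) \<partial>\<sigma>)"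
      unfolding W1_def by (rule INF_lower)
    also have "\<dots> \<le> (\<integral>\<^sup>+z. D (fst z) (snd z) \<partial>\<pi>) + 2 * emeasure \<rho> UNIV"
      unfolding \<sigma>_def using order_trans[OF 2(3) 1(3)] D
      by (intro nn_integral_add_measure_le s2 s\<rho> s) auto
    also have "2 * emeasure \<rho> UNIV = ennreal (2 * k)"
      using k by (simp add: \<rho>U ennreal_mult)
    also note T
    finally show ?thesis by (simp add: add_mono ac_simps)
  qed
  then show ?thesis by (rule W11_greatest[OF E(1) F(1)])
qed

section \<open>Charts and volumes of balls\<close>

lemma smooth_on_imp_continuous_on: "smooth_on S f \<Longrightarrow> continuous_on S f"
  unfolding smooth_on_def by (metis Ck_on.simps(1))

lemma smooth_on_imp_differentiable: "smooth_on S f \<Longrightarrow> x \<in> S \<Longrightarrow> f differentiable (at x)"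
  unfolding smooth_on_def by (metis Ck_on.simps(2))

text \<open>Intermediate value argument along a segment of matrices; applied to the Gram matrix of
  the metric to see that the volume density is positive.\<close>

lemma det_pos_if_pos_def:
  fixes A :: "real ^ 'n ^ 'n"
  assumes pos: "\<And>v. v \<noteq> 0 \<Longrightarrow> v \<bullet> (A *v v) > 0"
  shows "det A > 0"
proof (rule ccontr)
  assume neg: "\<not> det A > 0"
  \<comment> \<open>No matrix on the segment from the identity to \<open>A\<close> is singular.\<close>
  define B where "B t = (\<chi> i j. (1 - t) * mat 1 $ i $ j + t * A $ i $ j)" for t :: real
  have B: "B t = (1 - t) *\<^sub>R mat 1 + t *\<^sub>R A" for t by (simp add: B_def vec_eq_iff)
  have "continuous_on {0..1} (\<lambda>t. det (B t))"
    unfolding det_def B_def by (auto intro!: continuous_intros)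
  moreover have "det (B 0) = 1" "det (B 1) = det A" by (simp_all add: B)
  ultimately obtain t where t: "0 \<le> t" "t \<le> 1" "det (B t) = 0"
    using IVT2'[of "\<lambda>t. det (B t)" 1 0 0] neg by auto
  then have "\<not> inj ((*v) (B t))" by (simp add: det_nz_iff_inj[symmetric])
  then obtain v where v: "v \<noteq> 0" "B t *v v = 0"
    by (metis linear_injective_0 matrix_vector_mul_linear)
  have "v \<bullet> (B t *v v) = (1 - t) * (v \<bullet> v) + t * (v \<bullet> (A *v v))"
    by (simp add: B matrix_vector_mult_add_rdistrib scaleR_matrix_vector_assoc[symmetric] inner_add_right)
  moreover have "\<dots> > 0"
    using t pos[OF v(1)] v(1) by (cases "t = 0") (auto intro: add_nonneg_pos)
  ultimately show False using v by simp
qed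

lemma is_chartD:
  assumes "is_chart \<kappa>"
  shows "open (fst \<kappa>)" "open (snd \<kappa> ` fst \<kappa>)" "continuous_on (fst \<kappa>) (snd \<kappa>)"
    "continuous_on (snd \<kappa> ` fst \<kappa>) (inv_into (fst \<kappa>) (snd \<kappa>))"
    "p \<in> fst \<kappa> \<Longrightarrow> inv_into (fst \<kappa>) (snd \<kappa>) (snd \<kappa> p) = p"
  using assms unfolding is_chart_def homeomorphism_def by auto

text \<open>Intersected with the chart domain because the coordinate map is arbitrary outside
  it.\<close>

definition chart_preimage :: "('a, 'n::finite) chart \<Rightarrow> (real ^ 'n) set \<Rightarrow> 'a set" where
  "chart_preimage \<kappa> S = {p \<in> fst \<kappa>. snd \<kappa> p \<in> S}"

lemma open_chart_preimage: "is_chart \<kappa> \<Longrightarrow> open S \<Longrightarrow> open (chart_preimage \<kappa> S)"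
  using continuous_open_preimage[OF is_chartD(3,1), of \<kappa> S]
  by (simp add: chart_preimage_def vimage_def Int_def)

text \<open>It is the image of \<open>S\<close> under the continuous inverse chart. Compactness
  makes it closed in the whole Hausdorff manifold and not only in the chart domain.\<close>

lemma compact_chart_preimage:
  assumes "is_chart \<kappa>" "compact S" "S \<subseteq> snd \<kappa> ` fst \<kappa>"
  shows "compact (chart_preimage \<kappa> S)"
proof -
  have "chart_preimage \<kappa> S = inv_into (fst \<kappa>) (snd \<kappa>) ` S"
    using is_chartD(5)[OF assms(1)] assms(3) by (force simp: chart_preimage_def image_iff)
  then show ?thesis
    using compact_continuous_image[OF continuous_on_subset[OF is_chartD(4)[OF assms(1)] assms(3)] assms(2)]
    by simp
qed

lemma image_chart_preimage: "S \<subseteq> snd \<kappa> ` fst \<kappa> \<Longrightarrow> snd \<kappa> ` chart_preimage \<kappa> S = S"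
  by (auto simp: chart_preimage_def image_iff)

section \<open>Lengths of curves and distance balls in a chart\<close>

context riemannian_manifold
begin

text \<open>The chart picked by \<open>SOME\<close> in \<open>speed\<close> need not be \<kappa>;
  the chain rule through the transition map and \<open>metric_compat\<close> show that the choice
  does not matter.\<close>

lemma speed_eq:
  assumes \<kappa>: "\<kappa> \<in> atlas" and t: "\<gamma> t \<in> fst \<kappa>" and cont: "isCont \<gamma> t"
    and v: "((snd \<kappa> \<circ> \<gamma>) has_vector_derivative v) (at t)"
  shows "speed atlas g \<gamma> t = sqrt (g \<kappa> (snd \<kappa> (\<gamma> t)) v v)"
proof -
  define \<kappa>' where "\<kappa>' = (SOME \<kappa>. \<kappa> \<in> atlas \<and> \<gamma> t \<in> fst \<kappa>)"
  have \<kappa>': "\<kappa>' \<in> atlas" "\<gamma> t \<in> fst \<kappa>'"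
    using someI[of "\<lambda>\<kappa>. \<kappa> \<in> atlas \<and> \<gamma> t \<in> fst \<kappa>" \<kappa>] \<kappa> t unfolding \<kappa>'_def by auto
  define T where "T = transition \<kappa> \<kappa>'"
  define x where "x = snd \<kappa> (\<gamma> t)"
  have x: "x \<in> snd \<kappa> ` (fst \<kappa> \<inter> fst \<kappa>')" using t \<kappa>' by (auto simp: x_def)
  have "T differentiable (at x)"
    unfolding T_def by (rule smooth_on_imp_differentiable[OF smooth_transition[OF \<kappa> \<kappa>'(1)] x])
  then have T: "(T has_derivative frechet_derivative T (at x)) (at x)"
    by (simp add: frechet_derivative_works)
  have inv: "inv_into (fst \<kappa>) (snd \<kappa>) (snd \<kappa> p) = p" if "p \<in> fst \<kappa>" for p
    by (rule is_chartD(5)[OF charts[OF \<kappa>] that])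
  have "((T \<circ> (snd \<kappa> \<circ> \<gamma>)) has_vector_derivative frechet_derivative T (at x) v) (at t)"
    unfolding has_vector_derivative_def
  proof -
    have "((snd \<kappa> \<circ> \<gamma>) has_derivative (\<lambda>s. s *\<^sub>R v)) (at t)"
      using v by (simp add: has_vector_derivative_def)
    from diff_chain_at[OF this, of T] T
    have "((T \<circ> (snd \<kappa> \<circ> \<gamma>)) has_derivative (frechet_derivative T (at x) \<circ> (\<lambda>s. s *\<^sub>R v))) (at t)"
      by (simp add: x_def)
    then show "((T \<circ> (snd \<kappa> \<circ> \<gamma>)) has_derivative (\<lambda>s. s *\<^sub>R frechet_derivative T (at x) v)) (at t)"
      using linear_scale[OF has_derivative_linear[OF T]] by (simp add: o_def)
  qed
  \<comment> \<open>Near \<open>t\<close> the curve stays in the domain of \<kappa>, so there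
    \<open>T\<close> turns the coordinates of \<kappa> into those of the chosen chart.\<close>
  moreover obtain S where S: "open S" "t \<in> S" "\<And>s. s \<in> S \<Longrightarrow> \<gamma> s \<in> fst \<kappa>"
    using cont is_chartD(1)[OF charts[OF \<kappa>]] t unfolding continuous_at_open by metis
  ultimately have "((snd \<kappa>' \<circ> \<gamma>) has_vector_derivative frechet_derivative T (at x) v) (at t)"
    by - (rule has_vector_derivative_transform_within_open, assumption, use S in \<open>auto simp: T_def transition_def inv\<close>)
  then have vd: "vector_derivative (snd \<kappa>' \<circ> \<gamma>) (at t) = frechet_derivative T (at x) v"
    by (rule vector_derivative_at)
  have "T x = snd \<kappa>' (\<gamma> t)" using t by (simp add: T_def transition_def x_def inv)
  then show ?thesis
    unfolding speed_def Let_def \<kappa>'_def[symmetric] vd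
    using metric_compat[OF \<kappa> \<kappa>'(1) x, of v v] by (simp add: T_def x_def)
qed

text \<open>The coordinate displacement is the integral of the velocity, whose Euclidean norm times
  \<open>lam\<close> is at most the speed.\<close>

lemma curve_length_ge:
  assumes \<kappa>: "\<kappa> \<in> atlas" and \<gamma>: "piecewise_C1_curve atlas \<gamma>" and b: "0 \<le> b" "b \<le> 1"
    and dom: "\<And>t. t \<in> {0..b} \<Longrightarrow> \<gamma> t \<in> fst \<kappa>" and lam: "lam \<ge> 0"
    and g_ge: "\<And>t v. t \<in> {0..b} \<Longrightarrow> (lam * norm v)\<^sup>2 \<le> g \<kappa> (snd \<kappa> (\<gamma> t)) v v"
  shows "ennreal (lam * norm (snd \<kappa> (\<gamma> b) - snd \<kappa> (\<gamma> 0))) \<le> curve_length atlas g \<gamma>"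
proof -
  define w where "w = snd \<kappa> \<circ> \<gamma>"
  obtain S where S: "finite S" "w C1_differentiable_on {t \<in> {0<..<1} - S. \<gamma> t \<in> fst \<kappa>}"
    and cont: "continuous_on {0..1} \<gamma>"
    using \<gamma> \<kappa> unfolding piecewise_C1_curve_def w_def by blast
  define A where "A = {0<..<b} - S"
  have A: "A \<subseteq> {t \<in> {0<..<1} - S. \<gamma> t \<in> fst \<kappa>}" using b dom by (fastforce simp: A_def)
  obtain D where D: "\<And>t. t \<in> A \<Longrightarrow> (w has_vector_derivative D t) (at t)" "continuous_on A D"
    using C1_differentiable_on_subset[OF S(2) A] unfolding C1_differentiable_on_def by blast
  have Ab: "A \<in> sets borel" unfolding A_def using S(1) by (auto intro!: borel_open open_Diff finite_imp_closed)
  \<comment> \<open>The velocity, set to 0 at the break points and outside \<open>(0,b)\<close>,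
    which makes it Borel on the whole line.\<close>
  define F where "F t = indicator A t *\<^sub>R D t" for t
  have Fm [measurable]: "F \<in> borel_measurable borel"
    unfolding F_def by (rule borel_measurable_continuous_on_indicator[OF Ab D(2)])
  have contw: "continuous_on {0..b} w"
    unfolding w_def using b dom
    by (intro continuous_on_compose continuous_on_subset[OF cont]
        continuous_on_subset[OF is_chartD(3)[OF charts[OF \<kappa>]]]) auto
  \<comment> \<open>The velocity may be unbounded near the break points, so this is a Henstock-Kurzweil integral;
    it is a Lebesgue integral only when the length is finite.\<close>
  have FI: "(F has_integral (w b - w 0)) UNIV"
  proof (rule has_integral_on_superset)
    show "(F has_integral (w b - w 0)) {0..b}"
      by (rule fundamental_theorem_of_calculus_interior_strong[OF S(1) b(1) _ contw])
        (use D(1) in \<open>auto simp: F_def A_def\<close>)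
  qed (auto simp: F_def A_def)
  have "ennreal (norm (w b - w 0)) \<le> (\<integral>\<^sup>+t. norm (F t) \<partial>lborel)"
  proof (cases "(\<integral>\<^sup>+t. norm (F t) \<partial>lborel) < \<infinity>")
    case True
    then have int: "integrable lborel F" by (intro integrableI_bounded) simp_all
    then have "w b - w 0 = integral\<^sup>L lborel F"
      using has_integral_integral_lborel FI by (metis has_integral_unique)
    then show ?thesis using integral_norm_bound_ennreal[OF int] by simp
  qed (simp add: not_less top_unique)
  then have "ennreal (lam * norm (w b - w 0)) \<le> ennreal lam * (\<integral>\<^sup>+t. norm (F t) \<partial>lborel)"
    using lam by (simp add: ennreal_mult mult_left_mono)
  also have "\<dots> = (\<integral>\<^sup>+t. ennreal lam * norm (F t) \<partial>lborel)"
    by (simp add: nn_integral_cmult)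
  also have "\<dots> \<le> (\<integral>\<^sup>+t\<in>{0..1}. ennreal (speed atlas g \<gamma> t) \<partial>lborel)"
  proof (rule nn_integral_mono)
    fix t
    show "ennreal lam * norm (F t) \<le> ennreal (speed atlas g \<gamma> t) * indicator {0..1} t"
    proof (cases "t \<in> A")
      case True
      then have t: "t \<in> {0<..<1}" "t \<in> {0..b}" using b by (auto simp: A_def)
      have "isCont \<gamma> t" using continuous_on_interior[OF cont, of t] t by simp
      then have "speed atlas g \<gamma> t = sqrt (g \<kappa> (snd \<kappa> (\<gamma> t)) (D t) (D t))"
        using speed_eq[where \<gamma> = \<gamma> and t = t, OF \<kappa> dom[OF t(2)]] D(1)[OF True] unfolding w_def by blast
      then have "lam * norm (D t) \<le> speed atlas g \<gamma> t"
        using g_ge[OF t(2), of "D t"] by (simp add: real_le_rsqrt)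
      then show ?thesis using True t lam by (simp add: F_def ennreal_mult[symmetric] ennreal_leI)
    qed (simp add: F_def)
  qed
  finally show ?thesis unfolding curve_length_def w_def by simp
qed

text \<open>A curve that leaves the coordinate ball has covered coordinate distance \<open>s\<close>
  at its first exit, all of it where the metric is at least \<open>lam\<^sup>2\<close> times the
  Euclidean one, so its length is at least \<open>lam * s\<close>.\<close>

lemma riemannian_dist_less_imp_chart_ball:
  assumes \<kappa>: "\<kappa> \<in> atlas" and p: "p \<in> fst \<kappa>" and s: "0 < s" and lam: "0 < lam"
    and sub: "cball (snd \<kappa> p) s \<subseteq> snd \<kappa> ` fst \<kappa>"
    and g_ge: "\<And>x v. x \<in> cball (snd \<kappa> p) s \<Longrightarrow> (lam * norm v)\<^sup>2 \<le> g \<kappa> x v v"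
    and less: "riemannian_dist atlas g p q < ennreal (lam * s)"
  shows "q \<in> chart_preimage \<kappa> (ball (snd \<kappa> p) s)"
proof (rule ccontr)
  define V where "V = chart_preimage \<kappa> (ball (snd \<kappa> p) s)"
  define K where "K = chart_preimage \<kappa> (cball (snd \<kappa> p) s)"
  assume "q \<notin> chart_preimage \<kappa> (ball (snd \<kappa> p) s)"
  then have q: "q \<notin> V" by (simp add: V_def)
  obtain \<gamma> where \<gamma>: "piecewise_C1_curve atlas \<gamma>" "\<gamma> 0 = p" "\<gamma> 1 = q"
    and len: "curve_length atlas g \<gamma> < ennreal (lam * s)"
    using less unfolding riemannian_dist_def INF_less_iff by auto
  have cont: "continuous_on {0..1} \<gamma>" using \<gamma>(1) by (simp add: piecewise_C1_curve_def)
  have V: "open V" unfolding V_def by (rule open_chart_preimage[OF charts[OF \<kappa>]]) simp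
  have K: "closed K" unfolding K_def
    by (rule compact_imp_closed[OF compact_chart_preimage[OF charts[OF \<kappa>] _ sub]]) simp
  define T where "T = {0..1} \<inter> \<gamma> -` (- V)"
  have T: "closed T" unfolding T_def using V by (intro continuous_closed_preimage cont) auto
  have T1: "1 \<in> T" using q \<gamma> by (simp add: T_def)
  \<comment> \<open>The first exit time from the chart ball.\<close>
  define b where "b = Inf T"
  have bdd: "bdd_below T" by (rule bdd_belowI[of _ 0]) (simp add: T_def)
  have bT: "b \<in> T" unfolding b_def using T1 T bdd by (intro closed_contains_Inf) auto
  then have b01: "0 \<le> b" "b \<le> 1" by (auto simp: T_def)
  have "p \<in> V" using p s by (simp add: V_def chart_preimage_def)
  then have b0: "0 < b" using bT \<gamma> b01 by (cases "b = 0") (auto simp: T_def)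
  have before: "\<gamma> t \<in> V" if "t \<in> {0..<b}" for t
  proof (rule ccontr)
    assume "\<gamma> t \<notin> V"
    then have "t \<in> T" using that b01 by (simp add: T_def)
    then have "b \<le> t" unfolding b_def using bdd by (rule cInf_lower)
    then show False using that by simp
  qed
  have "V \<subseteq> K" by (auto simp: V_def K_def chart_preimage_def)
  then have "{0..<b} \<subseteq> {0..1} \<inter> \<gamma> -` K" using before b01 by fastforce
  \<comment> \<open>\<open>K\<close> is closed in the manifold, so the exit point
    \<gamma>(\<open>b\<close>) still lies in the chart domain and its coordinates are
    meaningful.\<close>
  then have "closure {0..<b} \<subseteq> {0..1} \<inter> \<gamma> -` K"
    by (rule closure_minimal) (intro continuous_closed_preimage cont K closed_atLeastAtMost)
  then have upto: "\<gamma> t \<in> K" if "t \<in> {0..b}" for t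
    using that b0 by auto
  have "ennreal (lam * norm (snd \<kappa> (\<gamma> b) - snd \<kappa> (\<gamma> 0))) \<le> curve_length atlas g \<gamma>"
    using upto lam by (intro curve_length_ge \<kappa> \<gamma> b01 g_ge) (auto simp: K_def chart_preimage_def)
  with len have "ennreal (lam * norm (snd \<kappa> (\<gamma> b) - snd \<kappa> p)) < ennreal (lam * s)"
    using \<gamma> by (meson le_less_trans)
  then have "norm (snd \<kappa> (\<gamma> b) - snd \<kappa> p) < s"
    using lam by (simp add: ennreal_less_iff)
  then have "\<gamma> b \<in> V"
    using upto[of b] b0 by (simp add: V_def K_def chart_preimage_def dist_norm norm_minus_commute)
  then show False using bT by (simp add: T_def)
qed

section \<open>Comparison of the metric with the Euclidean one\<close>

lemma metric_scaleR:
  assumes "\<kappa> \<in> atlas" "x \<in> snd \<kappa> ` fst \<kappa>"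
  shows "g \<kappa> x (a *\<^sub>R v) (b *\<^sub>R w) = a * b * g \<kappa> x v w"
  using metric_bilinear[OF assms] by (simp add: bilinear_lmul bilinear_rmul)

text \<open>\<open>metric_smooth\<close> speaks of fixed vectors only; joint continuity in the point
  and the vector is read off this expansion.\<close>

lemma metric_eq_sum:
  assumes "\<kappa> \<in> atlas" "x \<in> snd \<kappa> ` fst \<kappa>"
  shows "g \<kappa> x v v = (\<Sum>i\<in>UNIV. \<Sum>j\<in>UNIV. v $ i * v $ j * g \<kappa> x (axis i 1) (axis j 1))"
proof -
  have v: "v = (\<Sum>i\<in>UNIV. v $ i *\<^sub>R axis i 1)"
    using basis_expansion[of v] by (simp add: scalar_mult_eq_scaleR)
  have "g \<kappa> x v v = g \<kappa> x (\<Sum>i\<in>UNIV. v $ i *\<^sub>R axis i 1) (\<Sum>i\<in>UNIV. v $ i *\<^sub>R axis i 1)"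
    using v by simp
  also have "\<dots> = (\<Sum>i\<in>UNIV. \<Sum>j\<in>UNIV. g \<kappa> x (v $ i *\<^sub>R axis i 1) (v $ j *\<^sub>R axis j 1))"
    by (simp add: bilinear_sum[OF metric_bilinear[OF assms]] sum.cartesian_product)
  finally show ?thesis by (simp add: metric_scaleR[OF assms])
qed

lemma continuous_on_metric: "\<kappa> \<in> atlas \<Longrightarrow> continuous_on (snd \<kappa> ` fst \<kappa>) (\<lambda>x. g \<kappa> x v w)"
  by (rule smooth_on_imp_continuous_on[OF metric_smooth])

text \<open>\<open>lam\<^sup>2\<close> is the minimum of the metric over \<open>K\<close> times the
  unit sphere, positive by compactness; homogeneity extends the bound to all vectors.\<close>

lemma metric_ge_on_compact:
  assumes \<kappa>: "\<kappa> \<in> atlas" and K: "compact K" "K \<subseteq> snd \<kappa> ` fst \<kappa>"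
  obtains lam where "lam > 0" "\<And>x v. x \<in> K \<Longrightarrow> (lam * norm v)\<^sup>2 \<le> g \<kappa> x v v"
proof (cases "K = {}")
  case True
  then show ?thesis using that[of 1] by simp
next
  case False
  define f where "f z = g \<kappa> (fst z) (snd z) (snd z)" for z
  have "f z = (\<Sum>i\<in>UNIV. \<Sum>j\<in>UNIV. snd z $ i * snd z $ j * g \<kappa> (fst z) (axis i 1) (axis j 1))"
    if "z \<in> K \<times> sphere 0 1" for z
    unfolding f_def using that K by (intro metric_eq_sum[OF \<kappa>]) auto
  moreover have "continuous_on (K \<times> sphere 0 1)
     (\<lambda>z. \<Sum>i\<in>UNIV. \<Sum>j\<in>UNIV. snd z $ i * snd z $ j * g \<kappa> (fst z) (axis i 1) (axis j 1))"
    using K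
    by (intro continuous_intros continuous_on_compose2[OF continuous_on_metric[OF \<kappa>]]) auto
  ultimately have cont: "continuous_on (K \<times> sphere 0 1) f"
    by (subst continuous_on_cong[OF refl]) auto
  have ne: "K \<times> sphere (0 :: real ^ 'n) 1 \<noteq> {}" using False by simp
  obtain z where z: "z \<in> K \<times> sphere 0 1" "\<And>y. y \<in> K \<times> sphere 0 1 \<Longrightarrow> f z \<le> f y"
    using continuous_attains_inf[OF compact_Times[OF K(1) compact_sphere] ne cont] by blast
  have pos: "f z > 0"
    unfolding f_def using z(1) K by (intro metric_pos[OF \<kappa>]) auto
  show ?thesis
  proof (rule that[of "sqrt (f z)"])
    fix x and v :: "real ^ 'n" assume x: "x \<in> K"
    then have x': "x \<in> snd \<kappa> ` fst \<kappa>" using K by auto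
    show "(sqrt (f z) * norm v)\<^sup>2 \<le> g \<kappa> x v v"
    proof (cases "v = 0")
      case True
      then show ?thesis using metric_scaleR[OF \<kappa> x', of 0 0 0 0] by simp
    next
      case False
      define u where "u = (1 / norm v) *\<^sub>R v"
      have u: "v = norm v *\<^sub>R u" "norm u = 1" using False by (simp_all add: u_def)
      have "f z \<le> g \<kappa> x u u" using z(2)[of "(x, u)"] u x by (simp add: f_def)
      then have "(norm v)\<^sup>2 * f z \<le> (norm v)\<^sup>2 * g \<kappa> x u u" by (rule mult_left_mono) simp
      also have "\<dots> = g \<kappa> x (norm v *\<^sub>R u) (norm v *\<^sub>R u)"
        by (simp only: metric_scaleR[OF \<kappa> x'] power2_eq_square)
      also have "\<dots> = g \<kappa> x v v"
        by (simp only: u(1)[symmetric])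
      finally show ?thesis using pos by (simp add: power_mult_distrib mult.commute)
    qed
  qed (use pos in simp)
qed

section \<open>Volume of small balls\<close>

definition volume_density :: "('a, 'n) chart \<Rightarrow> real ^ 'n \<Rightarrow> real" where
  "volume_density \<kappa> x = sqrt (det (\<chi> i j. g \<kappa> x (axis i 1) (axis j 1)))"

lemma continuous_on_volume_density:
  assumes "\<kappa> \<in> atlas"
  shows "continuous_on (snd \<kappa> ` fst \<kappa>) (volume_density \<kappa>)"
  unfolding volume_density_def det_def
  by (auto intro!: continuous_intros continuous_on_metric[OF assms])

lemma volume_density_pos:
  assumes "\<kappa> \<in> atlas" "x \<in> snd \<kappa> ` fst \<kappa>"
  shows "volume_density \<kappa> x > 0"
proof -
  have "v \<bullet> ((\<chi> i j. g \<kappa> x (axis i 1) (axis j 1)) *v v) = g \<kappa> x v v" for v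
    by (simp add: metric_eq_sum[OF assms] inner_vec_def matrix_vector_mult_def sum_distrib_left mult_ac)
  then show ?thesis
    unfolding volume_density_def using metric_pos[OF assms] by (simp add: det_pos_if_pos_def)
qed

lemma volume_chart_preimage:
  assumes vol: "riemannian_volume atlas g vol" and \<kappa>: "\<kappa> \<in> atlas"
    and S: "open S" "S \<subseteq> snd \<kappa> ` fst \<kappa>"
  shows "emeasure vol (chart_preimage \<kappa> S) = (\<integral>\<^sup>+x\<in>S. volume_density \<kappa> x \<partial>lborel)"
proof -
  have "chart_preimage \<kappa> S \<in> sets borel"
    by (intro borel_open open_chart_preimage charts \<kappa> S)
  moreover have "chart_preimage \<kappa> S \<subseteq> fst \<kappa>" by (auto simp: chart_preimage_def)
  ultimately show ?thesis
    using vol \<kappa> image_chart_preimage[OF S(2)] unfolding riemannian_volume_def volume_density_def by simp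
qed

text \<open>A distance ball of radius \<open>r\<close> lies in the coordinate ball of radius
  \<open>r / lam\<close>, where the volume density is bounded. The open set \<open>U\<close> stands
  for the distance ball, whose own measurability is then not at issue. Finite and positive volume of
  \<open>W\<close> makes the later normalization legitimate.\<close>

lemma ball_volume_le_local:
  assumes vol: "riemannian_volume atlas g vol"
  obtains W C r0 where "open W" "p \<in> W" "emeasure vol W < \<infinity>" "emeasure vol W > 0"
    "C \<ge> 0" "r0 > 0"
    "\<And>q r. q \<in> W \<Longrightarrow> 0 < r \<Longrightarrow> r \<le> r0 \<Longrightarrow>
       \<exists>U. open U \<and> {q'. riemannian_dist atlas g q q' < ennreal r} \<subseteq> U \<and>
         emeasure vol U \<le> ennreal (C * r ^ CARD('n))"
proof -
  obtain \<kappa> where \<kappa>: "\<kappa> \<in> atlas" "p \<in> fst \<kappa>" using cover by blast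
  define z where "z = snd \<kappa> p"
  have "z \<in> snd \<kappa> ` fst \<kappa>" using \<kappa> by (simp add: z_def)
  then obtain e where e: "e > 0" "cball z e \<subseteq> snd \<kappa> ` fst \<kappa>"
    using is_chartD(2)[OF charts[OF \<kappa>(1)]] open_contains_cball by metis
  obtain lam where lam: "lam > 0" "\<And>x v. x \<in> cball z e \<Longrightarrow> (lam * norm v)\<^sup>2 \<le> g \<kappa> x v v"
    using metric_ge_on_compact[OF \<kappa>(1) compact_cball e(2)] by blast
  obtain y where y: "y \<in> cball z e" "\<And>x. x \<in> cball z e \<Longrightarrow> volume_density \<kappa> x \<le> volume_density \<kappa> y"
    using continuous_attains_sup[OF compact_cball _ continuous_on_subset[OF continuous_on_volume_density[OF \<kappa>(1)] e(2)]]
      e(1) by (auto simp: cball_eq_empty not_le)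
  define L where "L = volume_density \<kappa> y"
  have L: "L > 0" unfolding L_def using volume_density_pos[OF \<kappa>(1)] y(1) e(2) by auto
  define u where "u = unit_ball_vol (real CARD('n))"
  have u: "u > 0" by (simp add: u_def)
  have vol_le: "emeasure vol (chart_preimage \<kappa> (ball x s)) \<le> ennreal (L * u * s ^ CARD('n))"
    if "ball x s \<subseteq> cball z e" "s > 0" for x s
  proof -
    have "emeasure vol (chart_preimage \<kappa> (ball x s)) = (\<integral>\<^sup>+x'\<in>ball x s. volume_density \<kappa> x' \<partial>lborel)"
      using that e by (intro volume_chart_preimage[OF vol \<kappa>(1)]) auto
    also have "\<dots> \<le> (\<integral>\<^sup>+x'. ennreal L * indicator (ball x s) x' \<partial>lborel)"
      using that y(2) by (intro nn_integral_mono) (auto simp: L_def ennreal_leI split: split_indicator)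
    also have "\<dots> = ennreal L * emeasure lborel (ball x s)"
      by (simp add: nn_integral_cmult_indicator)
    also have "\<dots> = ennreal (L * u * s ^ CARD('n))"
      using that L u by (simp add: emeasure_ball u_def ennreal_mult mult.assoc)
    finally show ?thesis .
  qed
  \<comment> \<open>Half the radius, so that coordinate balls of radius up to \<rho> around points
    of \<open>W\<close> stay in \<open>cball z e\<close>.\<close>
  define \<rho> where "\<rho> = e / 2"
  have \<rho>: "\<rho> > 0" using e by (simp add: \<rho>_def)
  define W where "W = chart_preimage \<kappa> (ball z \<rho>)"
  have sub: "cball x s \<subseteq> cball z e" if "x \<in> ball z \<rho>" "s \<le> \<rho>" for x s
    using that by (auto simp: cball_subset_cball_iff \<rho>_def dist_commute)
  have bz: "ball z \<rho> \<subseteq> cball z e" using e by (auto simp: \<rho>_def)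
  show ?thesis
  proof (rule that[of W "L * u / lam ^ CARD('n)" "lam * \<rho>"])
    show "open W" unfolding W_def by (rule open_chart_preimage[OF charts[OF \<kappa>(1)]]) simp
    show "p \<in> W" using \<kappa> \<rho> by (simp add: W_def chart_preimage_def z_def)
    show "emeasure vol W < \<infinity>"
      using vol_le[OF bz \<rho>] unfolding W_def by (auto intro: le_less_trans)
    show "emeasure vol W > 0"
    proof (rule ccontr)
      assume "\<not> 0 < emeasure vol W"
      then have "emeasure vol W = 0" by simp
      moreover have "emeasure vol W = (\<integral>\<^sup>+x\<in>ball z \<rho>. volume_density \<kappa> x \<partial>lborel)"
        unfolding W_def using bz e by (intro volume_chart_preimage[OF vol \<kappa>(1)]) auto
      moreover have "(\<lambda>x. indicator (ball z \<rho>) x *\<^sub>R volume_density \<kappa> x) \<in> borel_measurable borel"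
        using bz e by (intro borel_measurable_continuous_on_indicator
          continuous_on_subset[OF continuous_on_volume_density[OF \<kappa>(1)]]) auto
      then have "(\<lambda>x. ennreal (indicator (ball z \<rho>) x *\<^sub>R volume_density \<kappa> x)) \<in> borel_measurable lborel"
        by simp
      then have "(\<lambda>x. ennreal (volume_density \<kappa> x) * indicator (ball z \<rho>) x) \<in> borel_measurable lborel"
        by (rule measurable_cong[THEN iffD1, rotated]) (auto split: split_indicator)
      ultimately have "AE x in lborel. ennreal (volume_density \<kappa> x) * indicator (ball z \<rho>) x = 0"
        by (subst nn_integral_0_iff_AE[symmetric]) auto
      then have "AE x in lborel. x \<notin> ball z \<rho>"
      proof (rule AE_mp, intro AE_I2 impI notI)
        fix x assume "ennreal (volume_density \<kappa> x) * indicator (ball z \<rho>) x = 0" "x \<in> ball z \<rho>"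
        moreover from this have "x \<in> snd \<kappa> ` fst \<kappa>" using bz e by auto
        ultimately show False using volume_density_pos[OF \<kappa>(1), of x] by (simp add: ennreal_eq_0_iff)
      qed
      then have "emeasure lborel (ball z \<rho>) = 0"
        by (subst (asm) AE_iff_null) (auto simp: ball_def)
      then show False using \<rho> u by (simp add: emeasure_ball u_def)
    qed
    show "0 \<le> L * u / lam ^ CARD('n)" "0 < lam * \<rho>" using L u lam \<rho> by simp_all
    fix q r assume q: "q \<in> W" and r: "0 < r" "r \<le> lam * \<rho>"
    define s where "s = r / lam"
    have s: "0 < s" "s \<le> \<rho>" "r = lam * s" using r lam by (auto simp: s_def field_simps)
    have q': "q \<in> fst \<kappa>" "snd \<kappa> q \<in> ball z \<rho>" using q by (simp_all add: W_def chart_preimage_def)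
    note sub' = sub[OF q'(2) s(2)]
    show "\<exists>U. open U \<and> {q'. riemannian_dist atlas g q q' < ennreal r} \<subseteq> U \<and>
         emeasure vol U \<le> ennreal (L * u / lam ^ CARD('n) * r ^ CARD('n))"
    proof (intro exI[of _ "chart_preimage \<kappa> (ball (snd \<kappa> q) s)"] conjI subsetI)
      show "open (chart_preimage \<kappa> (ball (snd \<kappa> q) s))"
        by (rule open_chart_preimage[OF charts[OF \<kappa>(1)]]) simp
      show "x \<in> chart_preimage \<kappa> (ball (snd \<kappa> q) s)"
        if "x \<in> {q'. riemannian_dist atlas g q q' < ennreal r}" for x
        using that sub' e lam(2)
        by (intro riemannian_dist_less_imp_chart_ball[OF \<kappa>(1) q'(1) s(1) lam(1)]) (auto simp: s(3))
      show "emeasure vol (chart_preimage \<kappa> (ball (snd \<kappa> q) s)) \<le> ennreal (L * u / lam ^ CARD('n) * r ^ CARD('n))"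
        using vol_le[OF subset_trans[OF ball_subset_cball sub'] s(1)] lam(1)
        by (simp add: s(3) power_mult_distrib mult.assoc)
    qed
  qed
qed

text \<open>A finite subcover by the local neighbourhoods makes the constants uniform.\<close>

lemma ball_volume_le:
  assumes vol: "riemannian_volume atlas g vol" and compact: "compact (UNIV :: 'a set)"
  obtains C r0 where "C > 0" "r0 > 0" "emeasure vol UNIV < \<infinity>" "emeasure vol UNIV > 0"
    "\<And>q r. 0 < r \<Longrightarrow> r \<le> r0 \<Longrightarrow>
       \<exists>U. open U \<and> {q'. riemannian_dist atlas g q q' < ennreal r} \<subseteq> U \<and>
         emeasure vol U \<le> ennreal (C * r ^ CARD('n))"
proof -
  define Q where "Q p W C r0 \<longleftrightarrow> open W \<and> p \<in> W \<and> emeasure vol W < \<infinity> \<and> emeasure vol W > 0 \<and> C \<ge> 0 \<and> r0 > 0 \<and>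
      (\<forall>q r. q \<in> W \<longrightarrow> 0 < r \<longrightarrow> r \<le> r0 \<longrightarrow>
       (\<exists>U. open U \<and> {q'. riemannian_dist atlas g q q' < ennreal r} \<subseteq> U \<and>
         emeasure vol U \<le> ennreal (C * r ^ CARD('n))))" for p W C r0
  have "\<exists>W C r0. Q p W C r0" for p
    unfolding Q_def by (rule ball_volume_le_local[OF vol, of p]) blast
  then obtain W C r0 where Q: "\<And>p. Q p (W p) (C p) (r0 p)" by metis
  then have W: "\<And>p. open (W p)" "\<And>p. p \<in> W p" "\<And>p. emeasure vol (W p) < \<infinity>"
      "\<And>p. emeasure vol (W p) > 0" and C: "\<And>p. C p \<ge> 0" and r0: "\<And>p. r0 p > 0"
    by (simp_all add: Q_def)
  have U: "\<exists>U. open U \<and> {q'. riemannian_dist atlas g q q' < ennreal r} \<subseteq> U \<and>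
         emeasure vol U \<le> ennreal (C p * r ^ CARD('n))"
    if "q \<in> W p" "0 < r" "r \<le> r0 p" for p q r
    using Q[of p] that unfolding Q_def by blast
  obtain F where F: "finite F" "UNIV \<subseteq> (\<Union>p\<in>F. W p)"
    by (rule compactE_image[OF compact, of UNIV W]) (use W in auto)
  have ne: "F \<noteq> {}" using F(2) by auto
  have sv: "sets vol = sets borel" using vol by (simp add: riemannian_volume_def)
  have Ws: "W p \<in> sets vol" for p using W(1) by (simp add: sv)
  show ?thesis
  \<comment> \<open>The summand 1 makes the constant strictly positive, since it is divided by
    later.\<close>
  proof (rule that[of "1 + sum C F" "Min (r0 ` F)"])
    show "1 + sum C F > 0" using C by (simp add: add_pos_nonneg sum_nonneg)
    show "Min (r0 ` F) > 0" using F ne r0 by simp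
    have "emeasure vol UNIV \<le> (\<Sum>p\<in>F. emeasure vol (W p))"
      using F(2) Ws emeasure_subadditive_finite[OF F(1), of W vol] by (simp add: top.extremum_unique image_subset_iff)
    also have "\<dots> < \<infinity>" using F(1) W(3) by simp
    finally show "emeasure vol UNIV < \<infinity>" .
    have "emeasure vol (W undefined) \<le> emeasure vol UNIV" by (intro emeasure_mono) (auto simp: sv)
    then show "emeasure vol UNIV > 0" using W(4)[of undefined] by (rule less_le_trans[rotated])
    fix q r assume r: "0 < r" "r \<le> Min (r0 ` F)"
    obtain p where p: "p \<in> F" "q \<in> W p" using F(2) by auto
    have "r \<le> r0 p" using r(2) p(1) F(1) by (auto intro: order_trans Min_le)
    from U[OF p(2) r(1) this] obtain V where V: "open V"
      "{q'. riemannian_dist atlas g q q' < ennreal r} \<subseteq> V"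
      "emeasure vol V \<le> ennreal (C p * r ^ CARD('n))" by blast
    have "C p \<le> sum C F" using p F C by (intro member_le_sum) auto
    then have "C p * r ^ CARD('n) \<le> (1 + sum C F) * r ^ CARD('n)"
      using r by (intro mult_right_mono) auto
    then show "\<exists>U. open U \<and> {q'. riemannian_dist atlas g q q' < ennreal r} \<subseteq> U \<and>
         emeasure vol U \<le> ennreal ((1 + sum C F) * r ^ CARD('n))"
      using V by (meson ennreal_leI order_trans)
  qed
qed

end

section \<open>Empirical measures on a compact manifold\<close>

lemma ereal_le_enn2ereal_iff: "0 \<le> b \<Longrightarrow> ereal b \<le> enn2ereal w \<longleftrightarrow> ennreal b \<le> w"
  by (simp add: less_eq_ennreal.rep_eq enn2ereal_ennreal)

lemma
  assumes "sets M = sets borel" "0 < emeasure M UNIV" "emeasure M UNIV < \<infinity>"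
  shows normalized_finite: "normalized M \<in> finite_borel_measures"
    and measure_normalized: "measure (normalized M) A = measure M A / measure M UNIV"
    and normalized_UNIV: "measure (normalized M) UNIV = 1"
proof -
  have sp: "space M = UNIV" using sets_eq_imp_space_eq[OF assms(1)] by simp
  interpret M: finite_measure M using assms by (intro finite_measureI) (simp add: sp)
  have pos: "measure M UNIV > 0"
    using assms(2) by (simp add: M.emeasure_eq_measure)
  have n: "normalized M = scale_measure (ennreal (1 / measure M UNIV)) M"
    unfolding normalized_def sp using pos
    by (simp add: M.emeasure_eq_measure divide_ennreal flip: ennreal_1)
  show "normalized M \<in> finite_borel_measures"
    unfolding n finite_borel_measures_def using assms(1)
    by (auto intro!: finite_measureI simp: space_scale_measure ennreal_mult_eq_top_iff)
  show m: "measure (normalized M) A = measure M A / measure M UNIV" for A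
    unfolding n by simp
  show "measure (normalized M) UNIV = 1" unfolding m using pos by simp
qed

text \<open>For \<open>r = c1 / N powr (1/n)\<close>, with \<open>n\<close> the dimension, the
  \<open>N\<close> balls of radius \<open>r\<close> around the points have total volume at most
  \<open>N * C * r ^ n = C * c1 ^ n\<close>, half of the manifold or less, whence
  \<open>W11_ge_separated\<close> applies and \<open>c0 = c1 / 2\<close>.\<close>

lemma (in riemannian_manifold) ex_empirical_W11_bound:
  assumes vol: "riemannian_volume atlas g vol" and compact: "compact (UNIV :: 'a set)"
  shows "normalized vol \<in> finite_borel_measures" (is "?F \<in> _")
    and "measure (normalized vol) UNIV = 1"
    and "\<exists>c0>0. \<forall>N\<ge>1. \<forall>x. ennreal (c0 / real N powr (1 / real CARD('n)))
      \<le> W11 (riemannian_dist atlas g) (empirical N x) (normalized vol)"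
proof -
  let ?D = "riemannian_dist atlas g" and ?n = "CARD('n)"
  obtain C r0 where C: "C > 0" and r0: "r0 > 0"
    and V: "emeasure vol UNIV < \<infinity>" "emeasure vol UNIV > 0"
    and U: "\<And>q r. 0 < r \<Longrightarrow> r \<le> r0 \<Longrightarrow>
       \<exists>U. open U \<and> {q'. ?D q q' < ennreal r} \<subseteq> U \<and> emeasure vol U \<le> ennreal (C * r ^ ?n)"
    using ball_volume_le[OF vol compact] by metis
  have sv: "sets vol = sets borel" using vol by (simp add: riemannian_volume_def)
  show F: "?F \<in> finite_borel_measures" and F1: "measure ?F UNIV = 1"
    using normalized_finite[OF sv V(2,1)] normalized_UNIV[OF sv V(2,1)] by simp_all
  define v where "v = measure vol UNIV"
  have v: "v > 0" using V unfolding v_def by (simp add: measure_def enn2real_positive_iff)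
  \<comment> \<open>The three bounds serve the validity of the volume estimate, the condition
    \<open>r \<le> 2\<close> for separated sets, and a covered fraction of at most one half.\<close>
  define c1 where "c1 = min (min r0 2) ((v / (2 * C)) powr (1 / real ?n))"
  have c1: "c1 > 0" "c1 \<le> r0" "c1 \<le> 2" using r0 v C by (simp_all add: c1_def)
  have "c1 ^ ?n \<le> ((v / (2 * C)) powr (1 / real ?n)) ^ ?n"
    using c1(1) by (intro power_mono) (auto simp: c1_def)
  also have "\<dots> = v / (2 * C)"
    using v C by (simp add: powr_realpow[symmetric] powr_powr)
  finally have c1n: "c1 ^ ?n \<le> v / (2 * C)" .
  have "ennreal (c1 / 2 / real N powr (1 / real ?n)) \<le> W11 ?D (empirical N x) ?F"
    if N: "N \<ge> 1" for N x
  proof -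
    define r where "r = c1 / real N powr (1 / real ?n)"
    have N1: "real N powr (1 / real ?n) \<ge> 1" using N by (simp add: ge_one_powr_ge_zero)
    have "r > 0" unfolding r_def using c1(1) N1 by (intro divide_pos_pos) linarith+
    moreover have "r \<le> c1" using c1(1) N1 divide_left_mono[of 1 "real N powr (1 / real ?n)" c1] N by (simp add: r_def)
    ultimately have r: "r > 0" "r \<le> c1" .
    have rn: "r ^ ?n = c1 ^ ?n / real N"
      using N by (simp add: r_def power_divide powr_realpow[symmetric] powr_powr)
    have "\<forall>i. \<exists>U. open U \<and> {q'. ?D (x i) q' < ennreal r} \<subseteq> U \<and> emeasure vol U \<le> ennreal (C * r ^ ?n)"
      using U[OF r(1)] r(2) c1(2) by auto
    then obtain B where B: "\<And>i. open (B i)" "\<And>i. {q'. ?D (x i) q' < ennreal r} \<subseteq> B i"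
      "\<And>i. emeasure vol (B i) \<le> ennreal (C * r ^ ?n)" by metis
    define A where "A = x ` {..<N}"
    have Ab: "A \<in> sets borel" unfolding A_def by (intro borel_closed finite_imp_closed) simp
    have Bm: "measure ?F (B i) \<le> C * r ^ ?n / v" for i
    proof -
      have "measure vol (B i) \<le> C * r ^ ?n"
        using B(3)[of i] C r unfolding measure_def by (intro enn2real_leI) auto
      then show ?thesis
        unfolding measure_normalized[OF sv V(2,1)] v_def[symmetric] using v by (intro divide_right_mono) auto
    qed
    have "measure ?F (\<Union>i<N. B i) \<le> (\<Sum>i<N. measure ?F (B i))"
      using B(1) finite_borel_measuresD(1)[OF F]
      by (intro measure_UNION_le) auto
    also have "\<dots> \<le> (\<Sum>i<N. C * r ^ ?n / v)" by (intro sum_mono Bm)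
    also have "\<dots> = C * c1 ^ ?n / v" using N by (simp add: rn)
    also have "\<dots> \<le> 1 / 2" using c1n C v by (simp add: field_simps)
    finally have half: "measure ?F (\<Union>i<N. B i) \<le> 1 / 2" .
    have "measure (return borel (x i)) (- A) = 0" if "i < N" for i
      using that Ab by (subst measure_return) (auto simp: A_def)
    then have "measure (empirical N x) (- A) = 0" using N by (simp add: measure_empirical)
    moreover have "ennreal r \<le> ?D p q" if "p \<in> A" "q \<notin> (\<Union>i<N. B i)" for p q
      using that B(2) unfolding A_def by (force simp: not_less[symmetric])
    ultimately have "ennreal (r / 2) \<le> W11 ?D (empirical N x) ?F"
      using N r c1 B(1) half
      by (intro W11_ge_separated[where A = A and U = "\<Union>i<N. B i"] empirical_finite empirical_UNIV F F1 Ab) auto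
    then show ?thesis by (simp add: r_def mult.commute)
  qed
  then show "\<exists>c0>0. \<forall>N\<ge>1. \<forall>x. ennreal (c0 / real N powr (1 / real ?n)) \<le> W11 ?D (empirical N x) ?F"
    using c1(1) by (intro exI[of _ "c1 / 2"]) auto
qed

text \<open>Between probability measures \<open>W11\<close> never exceeds 2, as all mass may be
  removed, whereas \<open>W1\<close> grows with the diameter; an arbitrary \<open>W1\<close>
  constant therefore does not carry over to \<open>W11\<close>. It does if distances are at most 2,
  where the two agree on probability measures, and for constants up to \<open>c0\<close>, for which
  the bound is proved for \<open>W11\<close> itself.\<close>

theorem proposition3p3:
  fixes atlas :: "('a::{t2_space, second_countable_topology}, 'n::finite) chart set"
    and g :: "('a, 'n) chart \<Rightarrow> real ^ 'n \<Rightarrow> real ^ 'n \<Rightarrow> real ^ 'n \<Rightarrow> real"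
    and vol :: "'a measure"
  assumes "riemannian_manifold atlas g"
    and "compact (UNIV :: 'a set)"
    and "riemannian_volume atlas g vol"
  shows "\<exists>c0>0. empirical_W1_bound (riemannian_dist atlas g) (normalized vol) CARD('n) c0 \<and>
    (\<forall>c>0. empirical_W1_bound (riemannian_dist atlas g) (normalized vol) CARD('n) c \<longrightarrow>
       c \<le> c0 \<or> (\<forall>p q. riemannian_dist atlas g p q \<le> 2) \<longrightarrow>
       (\<forall>N1 N2 x y. N1 > 0 \<longrightarrow> N2 > 0 \<longrightarrow>
          ereal (c / real (N1 + N2) powr (1 / real CARD('n)) - 2 * real N2 / real (N1 + N2))
            \<le> enn2ereal (signed_W11 (riemannian_dist atlas g)
                 (signed_empirical N1 N2 x y) (measure (normalized vol)))))"
proof -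
  interpret riemannian_manifold atlas g by fact
  let ?D = "riemannian_dist atlas g" and ?F = "normalized vol" and ?d = "1 / real CARD('n)"
  note F = ex_empirical_W11_bound(1,2)[OF assms(3,2)]
  obtain c0 where c0: "c0 > 0"
    and le: "\<And>N x. N \<ge> 1 \<Longrightarrow> ennreal (c0 / real N powr ?d) \<le> W11 ?D (empirical N x) ?F"
    using ex_empirical_W11_bound(3)[OF assms(3,2)] by blast
  have fin: "empirical N x \<in> finite_borel_measures" "measure (empirical N x) UNIV = 1" if "N \<ge> 1"
    for N and x :: "nat \<Rightarrow> 'a"
    using that by (simp_all add: empirical_finite empirical_UNIV)
  have "empirical_W1_bound ?D ?F CARD('n) c0"
    unfolding empirical_W1_bound_def
  proof (intro allI impI)
    fix N :: nat and x :: "nat \<Rightarrow> 'a" assume N: "1 \<le> N"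
    have "emeasure (empirical N x) UNIV = emeasure ?F UNIV"
      using fin[OF N, of x] F finite_borel_measuresD(3)
      by (metis finite_measure.emeasure_eq_measure)
    then show "ereal (c0 / real N powr ?d) \<le> enn2ereal (W1 ?D (empirical N x) ?F)"
      using order_trans[OF le[OF N] W11_le_W1[OF fin(1)[OF N] F(1)]] c0
      by (simp add: ereal_le_enn2ereal_iff)
  qed
  moreover have "ereal (c / real (N1 + N2) powr ?d - 2 * real N2 / real (N1 + N2))
      \<le> enn2ereal (signed_W11 ?D (signed_empirical N1 N2 x y) (measure ?F))"
    if c: "c > 0" "empirical_W1_bound ?D ?F CARD('n) c" "c \<le> c0 \<or> (\<forall>p q. ?D p q \<le> 2)"
      and N: "N1 > 0" "N2 > 0" for c N1 N2 x y
  proof (rule signed_empirical_W11_ge[OF F(1) N])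
    fix z :: "nat \<Rightarrow> 'a"
    have N': "N1 + N2 \<ge> 1" using N by simp
    show "ennreal (c / real (N1 + N2) powr ?d) \<le> W11 ?D (empirical (N1 + N2) z) ?F"
      using c(3)
    proof
      assume "c \<le> c0"
      then have "ennreal (c / real (N1 + N2) powr ?d) \<le> ennreal (c0 / real (N1 + N2) powr ?d)"
        by (intro ennreal_leI divide_right_mono) auto
      then show ?thesis using le[OF N'] by (rule order_trans)
    next
      assume D: "\<forall>p q. ?D p q \<le> 2"
      have "ennreal (c / real (N1 + N2) powr ?d) \<le> W1 ?D (empirical (N1 + N2) z) ?F"
        using c(1,2) N' unfolding empirical_W1_bound_def by (subst ereal_le_enn2ereal_iff[symmetric]) auto
      also have "\<dots> \<le> W11 ?D (empirical (N1 + N2) z) ?F"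
        using W1_le_W11[OF fin[OF N'] F] D by blast
      finally show ?thesis .
    qed
  qed
  ultimately show ?thesis using c0 by blast
qed

end
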